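(* For every $\mathbf{a},\mathbf{a}^{*}\in l^{2}$ and every $0<\gamma<1$ the following formulas hold for $t\in\mathbb{R}$: $$\langle e^{tK}\mathbf{a},\mathbf{a}^{*}\rangle=\sum_{n\in\mathbb{Z}}\langle e^{(\gamma n\pi)K}\mathbf{a},\mathbf{a}^{*}\rangle\,\mathrm{sinc}\left(\frac{t}{\gamma\pi}-n\right),$$ where the series converges uniformly on compact subsets of $\mathbb{R}$; $$e^{tK}\mathbf{a}=\mathbf{a}+t\,\mathrm{sinc}\left(\frac{t}{\pi}\right)K\mathbf{a}+t\sum_{n\in\mathbb{Z}\setminus\{0\}}\frac{e^{n\pi K}\mathbf{a}-\mathbf{a}}{n\pi}\,\mathrm{sinc}\left(\frac{t}{\pi}-n\right),$$ where the series converges in the norm of $l^{2}$; and $$e^{tK}\mathbf{a}=\mathrm{sinc}\left(\frac{t}{\pi}\right)\mathbf{a}+t\,\mathrm{sinc}\left(\frac{t}{\pi}\right)K\mathbf{a}+\sum_{n\in\mathbb{Z}\setminus\{0\}}\frac{t}{n\pi}\,\mathrm{sinc}\left(\frac{t}{\pi}-n\right)e^{n\pi K}\mathbf{a},$$ where the series converges in $l^{2}$.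
   Context: $l^{2}$ is the Hilbert space of square-summable complex sequences $\mathbf{a}=(a_n)_{n\in\mathbb{Z}}$ with its natural inner product $\langle\cdot,\cdot\rangle$ (linear in the first argument). The Kak-Hilbert transform $K:l^2\to l^2$ is the bounded operator $K\mathbf{a}=\mathbf{b}$ with $b_m=\frac{2}{\pi}\sum_{n\ \mathrm{even}}\frac{a_n}{m-n}$ if $m$ is odd and $b_m=\frac{2}{\pi}\sum_{n\ \mathrm{odd}}\frac{a_n}{m-n}$ if $m$ is even. For $t\in\mathbb{R}$, $e^{tK}=\sum_{k=0}^{\infty}\frac{t^kK^k}{k!}$. The function $\mathrm{sinc}$ is $\mathrm{sinc}(t)=\frac{\sin(\pi t)}{\pi t}$ for $t\neq0$, $\mathrm{sinc}(0)=1$. *)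

theory Defs
  imports "HOL-Analysis.Analysis"
begin

section \<open>The Hilbert space of square-summable bilateral complex sequences\<close>

typedef ell2 = "{a :: int \<Rightarrow> complex. (\<lambda>n. (cmod (a n))\<^sup>2) summable_on UNIV}"
  morphisms ell2_nth Abs_ell2
  by (rule exI[of _ "\<lambda>_. 0"]) simp

setup_lifting type_definition_ell2

lemma ell2_eqI: "(\<And>n. ell2_nth a n = ell2_nth b n) \<Longrightarrow> a = b"
  by (simp add: ell2_nth_inject[symmetric] fun_eq_iff)

lemma ell2_summable_sq: "(\<lambda>n. (cmod (ell2_nth a n))\<^sup>2) summable_on UNIV"
  using ell2_nth[of a] by simp

lemma l2_summable_product:
  fixes a b :: "int \<Rightarrow> complex"
  assumes "(\<lambda>n. (cmod (a n))\<^sup>2) summable_on A" "(\<lambda>n. (cmod (b n))\<^sup>2) summable_on A"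
  shows "(\<lambda>n. a n * b n) summable_on A"
proof -
  have "(\<lambda>n. norm (a n * a n)) summable_on A" "(\<lambda>n. norm (b n * b n)) summable_on A"
    using assms by (simp_all add: norm_mult power2_eq_square)
  then show ?thesis
    by (rule abs_summable_summable[OF abs_summable_product])
qed

lemma l2_add:
  fixes a b :: "int \<Rightarrow> complex"
  assumes "(\<lambda>n. (cmod (a n))\<^sup>2) summable_on A" "(\<lambda>n. (cmod (b n))\<^sup>2) summable_on A"
  shows "(\<lambda>n. (cmod (a n + b n))\<^sup>2) summable_on A"
proof (rule summable_on_comparison_test)
  show "(\<lambda>n. 2 * (cmod (a n))\<^sup>2 + 2 * (cmod (b n))\<^sup>2) summable_on A"
    by (intro summable_on_add summable_on_cmult_right assms)
  fix n
  have "(cmod (a n + b n))\<^sup>2 \<le> (cmod (a n) + cmod (b n))\<^sup>2"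
    by (simp add: norm_triangle_ineq power_mono)
  also have "\<dots> \<le> 2 * (cmod (a n))\<^sup>2 + 2 * (cmod (b n))\<^sup>2"
    using zero_le_power2[of "cmod (a n) - cmod (b n)"]
    by (simp add: power2_eq_square algebra_simps)
  finally show "(cmod (a n + b n))\<^sup>2 \<le> 2 * (cmod (a n))\<^sup>2 + 2 * (cmod (b n))\<^sup>2" .
qed simp_all

instantiation ell2 :: real_vector
begin

lift_definition zero_ell2 :: ell2 is "\<lambda>_. 0" by simp

lift_definition plus_ell2 :: "ell2 \<Rightarrow> ell2 \<Rightarrow> ell2" is "\<lambda>a b n. a n + b n"
  by (rule l2_add)

lift_definition uminus_ell2 :: "ell2 \<Rightarrow> ell2" is "\<lambda>a n. - a n" by simp

lift_definition minus_ell2 :: "ell2 \<Rightarrow> ell2 \<Rightarrow> ell2" is "\<lambda>a b n. a n - b n"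
proof -
  fix a b :: "int \<Rightarrow> complex"
  assume "(\<lambda>n. (cmod (a n))\<^sup>2) summable_on UNIV" "(\<lambda>n. (cmod (b n))\<^sup>2) summable_on UNIV"
  then show "(\<lambda>n. (cmod (a n - b n))\<^sup>2) summable_on UNIV"
    using l2_add[of a UNIV "\<lambda>n. - b n"] by simp
qed

lift_definition scaleR_ell2 :: "real \<Rightarrow> ell2 \<Rightarrow> ell2" is "\<lambda>r a n. r *\<^sub>R a n"
  by (simp add: power_mult_distrib summable_on_cmult_right)

instance
  by standard (transfer; simp add: fun_eq_iff algebra_simps)+

end

text \<open>The natural inner product, linear in the first argument.\<close>

definition cinner :: "ell2 \<Rightarrow> ell2 \<Rightarrow> complex" where
  "cinner a b = (\<Sum>\<^sub>\<infinity>n. ell2_nth a n * cnj (ell2_nth b n))"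

lemma cinner_has_sum:
  "((\<lambda>n. ell2_nth a n * cnj (ell2_nth b n)) has_sum cinner a b) UNIV"
  unfolding cinner_def
  by (intro has_sum_infsum l2_summable_product) (simp_all add: ell2_summable_sq)

lemma Re_mult_cnj_self: "Re (z * cnj z) = (cmod z)\<^sup>2"
  by (metis Re_complex_of_real complex_norm_square)

lemma Re_cinner_self: "Re (cinner a a) = (\<Sum>\<^sub>\<infinity>n. (cmod (ell2_nth a n))\<^sup>2)"
proof -
  have "((\<lambda>n. Re (ell2_nth a n * cnj (ell2_nth a n))) has_sum Re (cinner a a)) UNIV"
    by (rule has_sum_Re[OF cinner_has_sum])
  then show ?thesis
    unfolding Re_mult_cnj_self by (rule infsumI[symmetric])
qed

instantiation ell2 :: real_inner
begin

definition inner_ell2 :: "ell2 \<Rightarrow> ell2 \<Rightarrow> real" where "inner_ell2 a b = Re (cinner a b)"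
definition norm_ell2 :: "ell2 \<Rightarrow> real" where "norm_ell2 a = sqrt (inner a a)"
definition sgn_ell2 :: "ell2 \<Rightarrow> ell2" where "sgn_ell2 a = a /\<^sub>R norm a"
definition dist_ell2 :: "ell2 \<Rightarrow> ell2 \<Rightarrow> real" where "dist_ell2 a b = norm (a - b)"
definition uniformity_ell2 :: "(ell2 \<times> ell2) filter" where
  "uniformity_ell2 = (INF e\<in>{0<..}. principal {(x, y). dist x y < e})"
definition open_ell2 :: "ell2 set \<Rightarrow> bool" where
  "open_ell2 U = (\<forall>x\<in>U. \<forall>\<^sub>F (x', y) in uniformity. x' = x \<longrightarrow> y \<in> U)"

instance
proof
  fix x y z :: ell2 and r :: real
  have "cnj (cinner y x) = cinner x y"
    unfolding cinner_def infsum_cnj[symmetric] by (simp add: mult.commute)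
  then show "inner x y = inner y x"
    unfolding inner_ell2_def by (metis cnj.sel(1))
  have "((\<lambda>n. ell2_nth x n * cnj (ell2_nth z n) + ell2_nth y n * cnj (ell2_nth z n))
      has_sum (cinner x z + cinner y z)) UNIV"
    by (intro has_sum_add cinner_has_sum)
  then have "cinner (x + y) z = cinner x z + cinner y z"
    unfolding cinner_def[of "x + y"] by (intro infsumI) (simp add: plus_ell2.rep_eq ring_distribs)
  then show "inner (x + y) z = inner x z + inner y z"
    by (simp add: inner_ell2_def)
  have "((\<lambda>n. of_real r * (ell2_nth x n * cnj (ell2_nth y n))) has_sum (of_real r * cinner x y)) UNIV"
    by (intro has_sum_cmult_right cinner_has_sum)
  then have "cinner (r *\<^sub>R x) y = of_real r * cinner x y"
    unfolding cinner_def[of "r *\<^sub>R x"]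
    by (intro infsumI) (simp add: scaleR_ell2.rep_eq scaleR_conv_of_real mult.assoc)
  then show "inner (r *\<^sub>R x) y = r * inner x y"
    by (simp add: inner_ell2_def)
  show "0 \<le> inner x x"
    by (simp add: inner_ell2_def Re_cinner_self infsum_nonneg)
  show "inner x x = 0 \<longleftrightarrow> x = 0"
  proof
    assume "inner x x = 0"
    then have "(\<Sum>\<^sub>\<infinity>n. (cmod (ell2_nth x n))\<^sup>2) = 0"
      by (simp add: inner_ell2_def Re_cinner_self)
    then have "(cmod (ell2_nth x n))\<^sup>2 = 0" for n
      using nonneg_infsum_le_0D[OF _ ell2_summable_sq[of x], of n] by simp
    then show "x = 0"
      by (intro ell2_eqI) (simp add: zero_ell2.rep_eq)
  qed (simp add: inner_ell2_def Re_cinner_self zero_ell2.rep_eq)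
qed (simp_all add: norm_ell2_def sgn_ell2_def dist_ell2_def uniformity_ell2_def open_ell2_def)

end

lemma norm_ell2_sq: "(norm (a :: ell2))\<^sup>2 = (\<Sum>\<^sub>\<infinity>n. (cmod (ell2_nth a n))\<^sup>2)"
  by (simp add: power2_norm_eq_inner inner_ell2_def Re_cinner_self)

lemma sum_le_norm_ell2:
  assumes "finite F"
  shows "(\<Sum>n\<in>F. (cmod (ell2_nth a n))\<^sup>2) \<le> (norm a)\<^sup>2"
  unfolding norm_ell2_sq by (rule finite_sum_le_infsum) (use assms ell2_summable_sq in auto)

lemma ell2_nth_le_norm: "cmod (ell2_nth a n) \<le> norm a"
  using sum_le_norm_ell2[of "{n}" a] by (simp add: power2_le_iff_abs_le)

lemma l2_bound:
  assumes "\<And>F. finite F \<Longrightarrow> (\<Sum>n\<in>F. (cmod (f n))\<^sup>2) \<le> B\<^sup>2" and "0 \<le> B"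
  shows "(\<lambda>n. (cmod (f n))\<^sup>2) summable_on (UNIV :: int set)"
    and "norm (Abs_ell2 f) \<le> B"
proof -
  show s: "(\<lambda>n. (cmod (f n))\<^sup>2) summable_on (UNIV :: int set)"
    by (rule nonneg_bdd_above_summable_on) (use assms in \<open>auto intro!: bdd_aboveI\<close>)
  have "(norm (Abs_ell2 f))\<^sup>2 \<le> B\<^sup>2"
    unfolding norm_ell2_sq using s assms
    by (auto simp: Abs_ell2_inverse intro!: infsum_le_finite_sums)
  then show "norm (Abs_ell2 f) \<le> B"
    using assms(2) by (rule power2_le_imp_le)
qed

instance ell2 :: banach
proof
  fix X :: "nat \<Rightarrow> ell2"
  assume X: "Cauchy X"
  have "Cauchy (\<lambda>k. ell2_nth (X k) n)" for n
  proof (rule CauchyI)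
    fix e :: real assume "0 < e"
    then obtain N where N: "\<And>i j. i \<ge> N \<Longrightarrow> j \<ge> N \<Longrightarrow> norm (X i - X j) < e"
      using CauchyD[OF X] by blast
    have "norm (ell2_nth (X i) n - ell2_nth (X j) n) < e" if "i \<ge> N" "j \<ge> N" for i j
      using N[OF that] ell2_nth_le_norm[of "X i - X j" n] by (simp add: minus_ell2.rep_eq)
    then show "\<exists>M. \<forall>m\<ge>M. \<forall>k\<ge>M. norm (ell2_nth (X m) n - ell2_nth (X k) n) < e" by blast
  qed
  then have "\<forall>n. \<exists>l. (\<lambda>k. ell2_nth (X k) n) \<longlonglongrightarrow> l"
    by (simp add: Cauchy_convergent_iff convergent_def)
  then obtain f where f: "\<And>n. (\<lambda>k. ell2_nth (X k) n) \<longlonglongrightarrow> f n" by metis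
  have key: "\<exists>N. \<forall>i\<ge>N. \<forall>F. finite F \<longrightarrow> (\<Sum>n\<in>F. (cmod (ell2_nth (X i) n - f n))\<^sup>2) \<le> e\<^sup>2"
    if "0 < e" for e :: real
  proof -
    obtain N where N: "\<And>i j. i \<ge> N \<Longrightarrow> j \<ge> N \<Longrightarrow> norm (X i - X j) < e"
      using CauchyD[OF X \<open>0 < e\<close>] by blast
    have "(\<Sum>n\<in>F. (cmod (ell2_nth (X i) n - f n))\<^sup>2) \<le> e\<^sup>2" if "i \<ge> N" "finite F" for i F
    proof (rule tendsto_upperbound)
      show "(\<lambda>j. \<Sum>n\<in>F. (cmod (ell2_nth (X i) n - ell2_nth (X j) n))\<^sup>2)
          \<longlonglongrightarrow> (\<Sum>n\<in>F. (cmod (ell2_nth (X i) n - f n))\<^sup>2)"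
        by (intro tendsto_intros f)
      have "(\<Sum>n\<in>F. (cmod (ell2_nth (X i) n - ell2_nth (X j) n))\<^sup>2) \<le> e\<^sup>2" if "j \<ge> N" for j
      proof -
        have "(\<Sum>n\<in>F. (cmod (ell2_nth (X i - X j) n))\<^sup>2) \<le> (norm (X i - X j))\<^sup>2"
          using \<open>finite F\<close> by (rule sum_le_norm_ell2)
        also have "\<dots> \<le> e\<^sup>2"
          using N[OF \<open>i \<ge> N\<close> that] by (intro power_mono) auto
        finally show ?thesis by (simp add: minus_ell2.rep_eq)
      qed
      then show "\<forall>\<^sub>F j in sequentially.
          (\<Sum>n\<in>F. (cmod (ell2_nth (X i) n - ell2_nth (X j) n))\<^sup>2) \<le> e\<^sup>2"
        unfolding eventually_sequentially by blast
    qed simp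
    then show ?thesis by blast
  qed
  obtain N where N: "\<And>F. finite F \<Longrightarrow> (\<Sum>n\<in>F. (cmod (ell2_nth (X N) n - f n))\<^sup>2) \<le> 1\<^sup>2"
    using key[of 1] by auto
  have "(\<lambda>n. (cmod (ell2_nth (X N) n - f n))\<^sup>2) summable_on UNIV"
    by (rule l2_bound[OF N]) simp_all
  from l2_add[OF ell2_summable_sq[of "X N"], of "\<lambda>n. - (ell2_nth (X N) n - f n)"] this
  have "(\<lambda>n. (cmod (f n))\<^sup>2) summable_on UNIV"
    by (simp add: norm_minus_commute)
  then have nth: "ell2_nth (Abs_ell2 f) = f"
    by (simp add: Abs_ell2_inverse)
  have "X \<longlonglongrightarrow> Abs_ell2 f"
  proof (rule LIMSEQ_I)
    fix r :: real assume "0 < r"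
    then obtain N where N: "\<And>i F. i \<ge> N \<Longrightarrow> finite F \<Longrightarrow>
        (\<Sum>n\<in>F. (cmod (ell2_nth (X i) n - f n))\<^sup>2) \<le> (r/2)\<^sup>2"
      using key[of "r/2"] by auto
    have "norm (X i - Abs_ell2 f) < r" if "i \<ge> N" for i
    proof -
      have "norm (Abs_ell2 (ell2_nth (X i - Abs_ell2 f))) \<le> r/2"
        using N[OF that] \<open>0 < r\<close> by (intro l2_bound) (simp_all add: minus_ell2.rep_eq nth)
      then show ?thesis
        using \<open>0 < r\<close> by (simp add: ell2_nth_inverse)
    qed
    then show "\<exists>N. \<forall>i\<ge>N. norm (X i - Abs_ell2 f) < r" by blast
  qed
  then show "convergent X" by (rule convergentI)
qed

section \<open>The Kak-Hilbert transform\<close>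

definition kak_seq :: "(int \<Rightarrow> complex) \<Rightarrow> int \<Rightarrow> complex" where
  "kak_seq a m =
     (if odd m then 2 / of_real pi * (\<Sum>\<^sub>\<infinity>n\<in>{n. even n}. a n / of_int (m - n))
      else 2 / of_real pi * (\<Sum>\<^sub>\<infinity>n\<in>{n. odd n}. a n / of_int (m - n)))"

text \<open>Boundedness on \<^typ>\<open>ell2\<close>: the columns of the matrix of the transform are orthogonal
  and of equal norm.\<close>

definition odd_recip :: "int \<Rightarrow> real" where
  "odd_recip j = (if odd j then 1 / of_int j else 0)"

lemma odd_recip_minus: "odd_recip (- j) = - odd_recip j"
  by (simp add: odd_recip_def)

lemma odd_recip_step:
  "((\<lambda>j. odd_recip j * odd_recip (j + 2)) has_sum 0) UNIV"
proof -
  let ?g = "\<lambda>j. odd_recip j * odd_recip (j + 2)"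
  have "(\<lambda>k. 1 / (2 * (2 * real k + 1))) \<longlonglongrightarrow> 0"
    by real_asymp
  from telescope_sums'[OF this]
  have "(\<lambda>k. 1 / (2 * (2 * real k + 1)) - 1 / (2 * (2 * real (Suc k) + 1))) sums (1/2)"
    by simp
  moreover have "1 / (2 * (2 * real k + 1)) - 1 / (2 * (2 * real (Suc k) + 1))
      = 1 / ((2 * real k + 1) * (2 * real k + 3))" for k
    by (simp add: divide_simps) (simp add: algebra_simps)
  ultimately have "(\<lambda>k. 1 / ((2 * real k + 1) * (2 * real k + 3))) sums (1/2)" by simp
  then have s: "((\<lambda>k. 1 / ((2 * real k + 1) * (2 * real k + 3))) has_sum (1/2)) UNIV"
    by (rule sums_nonneg_imp_has_sum) simp
  have "(?g has_sum (1/2)) {j. odd j \<and> 1 \<le> j} \<longleftrightarrow>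
      ((\<lambda>k. 1 / ((2 * real k + 1) * (2 * real k + 3))) has_sum (1/2)) UNIV"
    by (rule has_sum_reindex_bij_witness[where j = "\<lambda>j. nat ((j - 1) div 2)" and i = "\<lambda>k. 2 * int k + 1"])
       (auto simp: odd_recip_def add_ac elim!: oddE)
  with s have pos: "(?g has_sum (1/2)) {j. odd j \<and> 1 \<le> j}" by simp
  have "(?g has_sum (1/2)) {j. odd j \<and> j \<le> -3} \<longleftrightarrow>
      ((\<lambda>k. 1 / ((2 * real k + 1) * (2 * real k + 3))) has_sum (1/2)) UNIV"
  proof (rule has_sum_reindex_bij_witness[where j = "\<lambda>j. nat ((- j - 3) div 2)" and i = "\<lambda>k. - 2 * int k - 3"])
    fix j :: int assume "j \<in> {j. odd j \<and> j \<le> -3}"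
    then have "odd j" "j \<le> -3" by auto
    then obtain i where "j = 2 * i + 1" "i \<le> -2" by (auto elim!: oddE)
    then have k: "j = - 2 * int (nat (- i - 2)) - 3" by simp
    then obtain k where k: "j = - 2 * int k - 3" by blast
    show "1 / ((2 * real (nat ((- j - 3) div 2)) + 1) * (2 * real (nat ((- j - 3) div 2)) + 3)) = ?g j"
      by (simp add: k odd_recip_def divide_simps) (simp add: algebra_simps)
  qed (auto; presburger)+
  with s have neg: "(?g has_sum (1/2)) {j. odd j \<and> j \<le> -3}" by simp
  have mid: "(?g has_sum (-1)) {-1}"
    by (rule has_sum_finiteI) (simp_all add: odd_recip_def)
  have "(?g has_sum (1/2 + (1/2 + (-1)))) ({j. odd j \<and> 1 \<le> j} \<union> ({j. odd j \<and> j \<le> -3} \<union> {-1}))"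
    by (intro has_sum_Un_disjoint pos neg mid) auto
  moreover have "{j. odd j \<and> 1 \<le> j} \<union> ({j. odd j \<and> j \<le> -3} \<union> {-1}) = {j::int. odd j}"
    by (auto; presburger)
  ultimately have "(?g has_sum 0) {j. odd j}" by simp
  then show ?thesis
    by (rule has_sum_cong_neutral[THEN iffD1, rotated -1]) (auto simp: odd_recip_def)
qed


lemma odd_recip_shift:
  "((\<lambda>j. odd_recip j * odd_recip (j + 2 * int (Suc d))) has_sum 0) UNIV"
proof -
  have "((\<lambda>j. real d * (odd_recip j * odd_recip (j + 2 * int d))) has_sum 0) UNIV" for d
  proof (induction d)
    case (Suc d)
    let ?q = "2 * int d"
    have "((\<lambda>j. odd_recip (j + ?q) * odd_recip (j + ?q + 2)) has_sum 0) UNIV"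
      using odd_recip_step
      by (subst has_sum_reindex_bij_witness[where i = "\<lambda>j. j - ?q" and j = "\<lambda>j. j + ?q"
            and h = "\<lambda>j. odd_recip j * odd_recip (j + 2)" and T = UNIV and s' = 0]) auto
    from has_sum_add[OF Suc this]
    have "((\<lambda>j. real d * (odd_recip j * odd_recip (j + ?q))
        + odd_recip (j + ?q) * odd_recip (j + ?q + 2)) has_sum 0) UNIV" by simp
    moreover have "real d * (odd_recip j * odd_recip (j + ?q))
        + odd_recip (j + ?q) * odd_recip (j + ?q + 2)
        = real (Suc d) * (odd_recip j * odd_recip (j + 2 * int (Suc d)))" for j
    proof (cases "odd j")
      case True
      then have "j \<noteq> 0" "j + ?q \<noteq> 0" "j + ?q + 2 \<noteq> 0" by presburger+
      then have "real_of_int j \<noteq> 0" "real_of_int (j + ?q) \<noteq> 0" "real_of_int (j + ?q + 2) \<noteq> 0"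
        by (simp_all only: of_int_eq_0_iff not_False_eq_True)
      then show ?thesis
        using True by (simp add: odd_recip_def add_ac divide_simps) (simp add: algebra_simps)
    qed (simp add: odd_recip_def)
    ultimately show ?case by simp
  qed simp
  from has_sum_cmult_right[OF this[of "Suc d"], of "1 / real (Suc d)"] show ?thesis
    by (simp del: of_nat_Suc)
qed

lemma odd_recip_sq_summable: "(\<lambda>n. (odd_recip (m - n))\<^sup>2) summable_on UNIV"
proof -
  have s: "(\<lambda>k. (odd_recip (int k))\<^sup>2) summable_on UNIV"
  proof (rule summable_nonneg_imp_summable_on[OF summable_comparison_test])
    show "summable (\<lambda>k. 1 / (real k)\<^sup>2)"
      using inverse_power_summable[of 2, where 'a = real] by (simp add: divide_simps)
  qed (auto simp: odd_recip_def power_divide)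
  have "(\<lambda>n. (odd_recip n)\<^sup>2) summable_on range int"
    using s by (subst summable_on_reindex) (auto simp: o_def)
  moreover have "(\<lambda>n. (odd_recip n)\<^sup>2) summable_on range (\<lambda>k. - int k)"
    using s by (subst summable_on_reindex) (auto simp: o_def odd_recip_minus inj_def)
  moreover have "UNIV = range int \<union> (range (\<lambda>k. - int k) - range int)"
    by (auto simp: image_iff) (metis int_cases2)
  ultimately have "(\<lambda>n. (odd_recip n)\<^sup>2) summable_on UNIV"
    by (metis Diff_disjoint summable_on_Un_disjoint summable_on_subset_banach Diff_subset)
  then show ?thesis
    by (subst summable_on_reindex_bij_witness[where i = "\<lambda>n. m - n" and j = "\<lambda>n. m - n"
          and h = "\<lambda>n. (odd_recip n)\<^sup>2" and T = UNIV]) auto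
qed

definition kak_const :: real where
  "kak_const = (\<Sum>\<^sub>\<infinity>j. (odd_recip j)\<^sup>2)"

lemma kak_const_nonneg: "0 \<le> kak_const"
  unfolding kak_const_def by (intro infsum_nonneg) simp

lemma odd_recip_orth:
  "((\<lambda>m. odd_recip (m - n) * odd_recip (m - n')) has_sum (if n = n' then kak_const else 0)) UNIV"
proof -
  have shift: "((\<lambda>m. odd_recip (m - n) * odd_recip (m - n')) has_sum s) UNIV \<longleftrightarrow>
      ((\<lambda>j. odd_recip j * odd_recip (j + (n - n'))) has_sum s) UNIV" for n n' s
    by (rule has_sum_reindex_bij_witness[where j = "\<lambda>m. m - n" and i = "\<lambda>j. j + n"]) auto
  have sq: "(\<lambda>j. odd_recip j * odd_recip j) summable_on UNIV"
    using odd_recip_sq_summable[of 0]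
    by (simp add: odd_recip_minus power2_eq_square)
  have less: "((\<lambda>m. odd_recip (m - n) * odd_recip (m - n')) has_sum 0) UNIV" if "n' < n" for n n'
  proof (cases "even (n - n')")
    case True
    obtain d where "n - n' = 2 * int (Suc d)"
    proof -
      from True obtain c where c: "n - n' = 2 * c" by (rule evenE)
      show ?thesis
        by (rule that[of "nat (c - 1)"]) (use c \<open>n' < n\<close> in auto)
    qed
    then show ?thesis
      unfolding shift using odd_recip_shift[of d] by simp
  next
    case False
    then have "odd_recip j * odd_recip (j + (n - n')) = 0" for j
      by (simp add: odd_recip_def)
    then show ?thesis unfolding shift by (simp only: has_sum_0_simp)
  qed
  consider "n = n'" | "n' < n" | "n < n'" by linarith
  then show ?thesis
  proof cases
    case 1
    then show ?thesis
      unfolding shift using has_sum_infsum[OF sq] by (simp add: kak_const_def power2_eq_square)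
  next
    case 2
    then show ?thesis using less[of n' n] by simp
  next
    case 3
    then show ?thesis using less[of n n'] by (simp add: mult.commute)
  qed
qed

lemma has_sum_finite_sum:
  fixes f :: "'i \<Rightarrow> 'a \<Rightarrow> real"
  assumes "finite I" "\<And>i. i \<in> I \<Longrightarrow> (f i has_sum s i) A"
  shows "((\<lambda>x. \<Sum>i\<in>I. f i x) has_sum (\<Sum>i\<in>I. s i)) A"
  using assms by (induction I rule: finite_induct) (auto intro!: has_sum_add)

lemma kak_finite_bound:
  fixes a :: "int \<Rightarrow> complex"
  assumes F: "finite F" and M: "finite M"
  shows "(\<Sum>m\<in>M. (cmod (\<Sum>n\<in>F. a n * of_real (odd_recip (m - n))))\<^sup>2)
    \<le> kak_const * (\<Sum>n\<in>F. (cmod (a n))\<^sup>2)"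
proof -
  let ?h = odd_recip
  have "((\<lambda>m. \<Sum>n\<in>F. \<Sum>n'\<in>F. Re (a n * cnj (a n')) * (?h (m - n) * ?h (m - n')))
      has_sum (\<Sum>n\<in>F. \<Sum>n'\<in>F. Re (a n * cnj (a n')) * (if n = n' then kak_const else 0))) UNIV"
    by (intro has_sum_finite_sum F has_sum_cmult_right odd_recip_orth)
  moreover have "(\<Sum>n\<in>F. \<Sum>n'\<in>F. Re (a n * cnj (a n')) * (if n = n' then kak_const else 0))
      = kak_const * (\<Sum>n\<in>F. (cmod (a n))\<^sup>2)"
    using F by (simp add: sum_distrib_left if_distrib sum.delta Re_mult_cnj_self mult.commute
        del: times_complex.sel cong: if_cong)
  moreover have "(\<Sum>n\<in>F. \<Sum>n'\<in>F. Re (a n * cnj (a n')) * (?h (m - n) * ?h (m - n')))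
      = (cmod (\<Sum>n\<in>F. a n * of_real (?h (m - n))))\<^sup>2" for m
  proof -
    have "complex_of_real ((cmod (\<Sum>n\<in>F. a n * of_real (?h (m - n))))\<^sup>2)
        = (\<Sum>n\<in>F. \<Sum>n'\<in>F. a n * cnj (a n') * of_real (?h (m - n) * ?h (m - n')))"
      unfolding complex_norm_square by (simp add: sum_product mult_ac)
    then have "(cmod (\<Sum>n\<in>F. a n * of_real (?h (m - n))))\<^sup>2
        = Re (\<Sum>n\<in>F. \<Sum>n'\<in>F. a n * cnj (a n') * of_real (?h (m - n) * ?h (m - n')))"
      by (metis Re_complex_of_real)
    then show ?thesis by (simp del: of_real_mult)
  qed
  ultimately have hs: "((\<lambda>m. (cmod (\<Sum>n\<in>F. a n * of_real (?h (m - n))))\<^sup>2)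
      has_sum (kak_const * (\<Sum>n\<in>F. (cmod (a n))\<^sup>2))) UNIV" by simp
  show ?thesis
    by (rule finite_sum_le_has_sum[OF hs M]) auto
qed

lemma kak_summable:
  assumes "(\<lambda>n. (cmod (a n))\<^sup>2) summable_on UNIV"
  shows "(\<lambda>n. a n * of_real (odd_recip (m - n))) summable_on UNIV"
  by (intro l2_summable_product assms) (simp add: odd_recip_sq_summable)

lemma kak_seq_eq:
  "kak_seq a m = of_real (2 / pi) * (\<Sum>\<^sub>\<infinity>n. a n * of_real (odd_recip (m - n)))"
proof -
  have "(\<Sum>\<^sub>\<infinity>n\<in>{n. odd (m - n)}. a n / of_int (m - n))
      = (\<Sum>\<^sub>\<infinity>n. a n * of_real (odd_recip (m - n)))"
    by (rule infsum_cong_neutral) (auto simp: odd_recip_def)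
  moreover have "{n. odd (m - n)} = (if odd m then {n. even n} else {n. odd n})"
    by auto
  ultimately show ?thesis
    by (simp add: kak_seq_def split: if_splits)
qed

lemma kak_seq_bound:
  assumes "finite M"
  shows "(\<Sum>m\<in>M. (cmod (kak_seq (ell2_nth a) m))\<^sup>2)
    \<le> (2 / pi * sqrt kak_const * norm a)\<^sup>2"
proof -
  let ?s = "\<lambda>F m. \<Sum>n\<in>F. ell2_nth a n * of_real (odd_recip (m - n))"
  have "(\<Sum>m\<in>M. (cmod (\<Sum>\<^sub>\<infinity>n. ell2_nth a n * of_real (odd_recip (m - n))))\<^sup>2)
      \<le> kak_const * (norm a)\<^sup>2"
  proof (rule tendsto_upperbound)
    show "((\<lambda>F. \<Sum>m\<in>M. (cmod (?s F m))\<^sup>2) \<longlongrightarrow>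
        (\<Sum>m\<in>M. (cmod (\<Sum>\<^sub>\<infinity>n. ell2_nth a n * of_real (odd_recip (m - n))))\<^sup>2))
        (finite_subsets_at_top UNIV)"
      by (intro tendsto_intros infsum_tendsto kak_summable ell2_summable_sq)
    show "\<forall>\<^sub>F F in finite_subsets_at_top UNIV.
        (\<Sum>m\<in>M. (cmod (?s F m))\<^sup>2) \<le> kak_const * (norm a)\<^sup>2"
    proof (rule eventually_finite_subsets_at_top_weakI)
      fix F :: "int set" assume "finite F"
      show "(\<Sum>m\<in>M. (cmod (?s F m))\<^sup>2) \<le> kak_const * (norm a)\<^sup>2"
        by (rule order.trans[OF kak_finite_bound[OF \<open>finite F\<close> assms]])
           (intro mult_left_mono sum_le_norm_ell2 \<open>finite F\<close> kak_const_nonneg)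
    qed
  qed simp
  then have "(2 / pi)\<^sup>2 * (\<Sum>m\<in>M. (cmod (\<Sum>\<^sub>\<infinity>n. ell2_nth a n * of_real (odd_recip (m - n))))\<^sup>2)
      \<le> (2 / pi)\<^sup>2 * (kak_const * (norm a)\<^sup>2)"
    by (rule mult_left_mono) simp
  also have "\<dots> = (2 / pi * sqrt kak_const * norm a)\<^sup>2"
    by (simp add: power_mult_distrib power_divide kak_const_nonneg)
  finally show ?thesis
    unfolding kak_seq_eq norm_mult norm_of_real
    by (simp only: power_mult_distrib power2_abs sum_distrib_left[symmetric])
qed

lemma kak_seq_l2:
  shows "(\<lambda>m. (cmod (kak_seq (ell2_nth a) m))\<^sup>2) summable_on UNIV"
    and "norm (Abs_ell2 (kak_seq (ell2_nth a))) \<le> 2 / pi * sqrt kak_const * norm a"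
  by (rule l2_bound[OF kak_seq_bound]; simp add: kak_const_nonneg)+

lift_definition kak_fun :: "ell2 \<Rightarrow> ell2" is kak_seq
  by (metis Abs_ell2_inverse CollectI kak_seq_l2(1))

lemma kak_fun_eq: "kak_fun a = Abs_ell2 (kak_seq (ell2_nth a))"
  by (metis ell2_nth_inverse kak_fun.rep_eq)

lift_definition kak :: "ell2 \<Rightarrow>\<^sub>L ell2" is kak_fun
proof (rule bounded_linear_intro)
  fix a b :: ell2 and r :: real
  show "kak_fun (a + b) = kak_fun a + kak_fun b"
    by (rule ell2_eqI, simp only: kak_fun.rep_eq plus_ell2.rep_eq kak_seq_eq)
       (simp add: ring_distribs infsum_add kak_summable ell2_summable_sq add_divide_distrib)
  show "kak_fun (r *\<^sub>R a) = r *\<^sub>R kak_fun a"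
    by (rule ell2_eqI, simp only: kak_fun.rep_eq scaleR_ell2.rep_eq kak_seq_eq)
       (simp add: scaleR_conv_of_real mult.assoc infsum_cmult_right' mult.left_commute)
  show "norm (kak_fun a) \<le> norm a * (2 / pi * sqrt kak_const)"
    using kak_seq_l2(2)[of a] by (simp add: kak_fun_eq mult.commute)
qed

lemma ell2_nth_kak: "ell2_nth (blinfun_apply kak a) = kak_seq (ell2_nth a)"
  by (simp add: kak.rep_eq kak_fun.rep_eq)

section \<open>The group generated by the transform, sampling series\<close>

text \<open>The series is taken in the operator norm.\<close>

definition exp_kak :: "real \<Rightarrow> ell2 \<Rightarrow>\<^sub>L ell2" where
  "exp_kak t = (\<Sum>k. (t ^ k / fact k) *\<^sub>R (((o\<^sub>L) kak) ^^ k) id_blinfun)"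

lemma exp_kak_sums: "(\<lambda>k. (t ^ k / fact k) *\<^sub>R (((o\<^sub>L) kak) ^^ k) id_blinfun) sums exp_kak t"
proof -
  have pow: "norm ((((o\<^sub>L) kak) ^^ k) id_blinfun) \<le> norm kak ^ k" for k
  proof (induction k)
    case 0
    show ?case by (simp add: norm_blinfun_id_le)
  next
    case (Suc k)
    have "norm ((((o\<^sub>L) kak) ^^ Suc k) id_blinfun)
        \<le> norm kak * norm ((((o\<^sub>L) kak) ^^ k) id_blinfun)"
      by (simp add: norm_blinfun_compose)
    also have "\<dots> \<le> norm kak * norm kak ^ k"
      by (intro mult_left_mono Suc) simp
    finally show ?case by simp
  qed
  have "summable (\<lambda>k. (t ^ k / fact k) *\<^sub>R (((o\<^sub>L) kak) ^^ k) id_blinfun)"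
  proof (rule summable_comparison_test)
    show "summable (\<lambda>k. inverse (fact k) * (\<bar>t\<bar> * norm kak) ^ k)"
      by (rule summable_exp)
    have "norm ((t ^ k / fact k) *\<^sub>R (((o\<^sub>L) kak) ^^ k) id_blinfun)
        \<le> inverse (fact k) * (\<bar>t\<bar> * norm kak) ^ k" for k
      using mult_left_mono[OF pow[of k], of "\<bar>t\<bar> ^ k / fact k"]
      by (simp add: power_abs power_mult_distrib field_simps)
    then show "\<exists>N. \<forall>k\<ge>N. norm ((t ^ k / fact k) *\<^sub>R (((o\<^sub>L) kak) ^^ k) id_blinfun)
        \<le> inverse (fact k) * (\<bar>t\<bar> * norm kak) ^ k" by blast
  qed
  then show ?thesis unfolding exp_kak_def by (rule summable_sums)
qed

definition sinc :: "real \<Rightarrow> real" where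
  "sinc t = (if t = 0 then 1 else sin (pi * t) / (pi * t))"

text \<open>Series indexed by \<^term>\<open>A\<close>, a set of integers, are bilateral: the two truncation bounds
  tend to infinity independently of each other. (Unordered summation would be too strong, as
  sampling series need not converge unconditionally.)\<close>

definition bilateral_sum :: "(int \<Rightarrow> 'a::comm_monoid_add) \<Rightarrow> int set \<Rightarrow> nat \<times> nat \<Rightarrow> 'a" where
  "bilateral_sum f A = (\<lambda>(M, N). \<Sum>n\<in>A \<inter> {- int M..int N}. f n)"

definition has_bilateral_sum ::
    "(int \<Rightarrow> 'a::{comm_monoid_add, topological_space}) \<Rightarrow> int set \<Rightarrow> 'a \<Rightarrow> bool" where
  "has_bilateral_sum f A s \<longleftrightarrow>
     (bilateral_sum f A \<longlongrightarrow> s) (sequentially \<times>\<^sub>F sequentially)"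

end

theory Submission
  imports Defs
begin

text \<open>The matrix of the transform is a convolution with the odd kernel \<open>2 / (pi * j)\<close>, \<open>j\<close> odd.
  Its columns are orthogonal, and of norm one by the Basel sum; antisymmetry turns this into
  \<open>K (K a) = - a\<close> (\<open>kak_kak\<close>). Therefore \<open>exp (t K) = cos t + sin t K\<close> (\<open>exp_kak_eq\<close>), and each of the claims
  becomes a statement about the interpolation of trigonometric functions by shifted cardinal
  sines.

  For the two series in norm, \<open>exp (n pi K) a = cos (n * pi) a\<close> and \<open>t * sinc (t / pi) = sin t\<close>.
  With \<open>x = t / pi\<close>, the last series is \<open>a\<close> times the regularised interpolation series, with terms
  \<open>(x / n) f(n) sinc (x - n)\<close>, of \<open>f(x) = cos (pi * x)\<close>, and \<open>t\<close> times the other one is the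
  difference of this series and the one of the constant \<open>1\<close>. These two scalar identities are the partial
  fraction expansions of the cotangent and of the cosecant multiplied by \<open>sin (pi * x) / pi\<close>. The
  cotangent expansion follows from the reflection formula of the Gamma function, and the cosecant
  expansion from \<open>1 / sin (2 u) = cot u - cot (2 u)\<close>. The factor \<open>x / n\<close> makes the series
  absolutely convergent, so that the order of summation is irrelevant.

  For the weak sampling formula put \<open>\<sigma> = \<gamma> * pi < pi\<close>; it has to be shown that the plain series
  with terms \<open>cis (\<sigma> n) sinc (x - n)\<close> converges to \<open>cis (\<sigma> x)\<close>, uniformly for bounded \<open>x\<close>. For
  \<open>\<sigma> = 0\<close> this is the interpolation of the constant together with the convergence of the alternating
  harmonic series. Differentiating the truncated series times \<open>cis (- \<sigma> x)\<close> with respect to \<open>\<sigma>\<close>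
  removes the denominators and leaves a geometric sum, whose two end terms oscillate rapidly and
  are divided by \<open>1 + cis \<sigma>\<close>. This factor stays away from zero below the critical frequency, and
  an integration by parts shows that the increment from \<open>0\<close> to \<open>\<sigma>\<close> tends to zero
  (\<open>sampling_remainder_bound\<close>).\<close>

section \<open>The square of the transform\<close>

lemma has_sum_inverse_square_int:
  "((\<lambda>j::int. 1 / (of_int j)\<^sup>2 :: real) has_sum (pi\<^sup>2 / 3)) (UNIV - {0})"
proof -
  have s: "((\<lambda>k. 1 / (real (k + 1))\<^sup>2) has_sum (pi\<^sup>2 / 6)) UNIV"
    using inverse_squares_sums by (intro sums_nonneg_imp_has_sum) (auto simp: add_ac)
  have "((\<lambda>j::int. 1 / (of_int j)\<^sup>2 :: real) has_sum (pi\<^sup>2 / 6)) {1..} \<longleftrightarrow>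
      ((\<lambda>k. 1 / (real (k + 1))\<^sup>2) has_sum (pi\<^sup>2 / 6)) UNIV"
    by (rule has_sum_reindex_bij_witness[where j = "\<lambda>j. nat (j - 1)" and i = "\<lambda>k. int k + 1"]) auto
  moreover have "((\<lambda>j::int. 1 / (of_int j)\<^sup>2 :: real) has_sum (pi\<^sup>2 / 6)) {..-1} \<longleftrightarrow>
      ((\<lambda>k. 1 / (real (k + 1))\<^sup>2) has_sum (pi\<^sup>2 / 6)) UNIV"
    by (rule has_sum_reindex_bij_witness[where j = "\<lambda>j. nat (- j - 1)" and i = "\<lambda>k. - int k - 1"])
       (auto simp: power2_eq_square algebra_simps)
  ultimately have "((\<lambda>j::int. 1 / (of_int j)\<^sup>2 :: real)
      has_sum (pi\<^sup>2 / 6 + pi\<^sup>2 / 6)) ({1..} \<union> {..-1})"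
    using s by (intro has_sum_Un_disjoint) auto
  moreover have "{1..} \<union> {..-1} = UNIV - {0::int}" by auto
  ultimately show ?thesis by simp
qed

text \<open>The odd squares carry three quarters of the Basel sum, because the even ones carry a quarter
  of it. This is the value that makes the factor \<open>2 / pi\<close> in the transform a normalisation to an
  isometry.\<close>

lemma kak_const_eq: "kak_const = pi\<^sup>2 / 4"
proof -
  let ?f = "\<lambda>j::int. 1 / (of_int j)\<^sup>2 :: real"
  have "(?f has_sum (1 / 4 * (pi\<^sup>2 / 3))) {j. even j \<and> j \<noteq> 0} \<longleftrightarrow>
      ((\<lambda>j. 1 / 4 * ?f j) has_sum (1 / 4 * (pi\<^sup>2 / 3))) (UNIV - {0})"
    by (rule has_sum_reindex_bij_witness[where j = "\<lambda>j. j div 2" and i = "\<lambda>k. 2 * k"])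
       (auto simp: power2_eq_square elim!: evenE)
  then have "(?f has_sum (1 / 4 * (pi\<^sup>2 / 3))) {j. even j \<and> j \<noteq> 0}"
    using has_sum_cmult_right[OF has_sum_inverse_square_int] by blast
  with has_sum_inverse_square_int
  have "(?f has_sum (pi\<^sup>2 / 3 - 1 / 4 * (pi\<^sup>2 / 3))) ((UNIV - {0}) - {j. even j \<and> j \<noteq> 0})"
    by (rule has_sum_Diff) auto
  moreover have "(UNIV - {0}) - {j. even j \<and> j \<noteq> 0} = {j::int. odd j}" by auto
  ultimately have "(?f has_sum (pi\<^sup>2 / 4)) {j. odd j}" by simp
  then have "((\<lambda>j. (odd_recip j)\<^sup>2) has_sum (pi\<^sup>2 / 4)) UNIV"
    by (rule has_sum_cong_neutral[THEN iffD1, rotated -1]) (auto simp: odd_recip_def power_divide)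
  then show ?thesis unfolding kak_const_def by (rule infsumI)
qed

lift_definition ell2_single :: "int \<Rightarrow> complex \<Rightarrow> ell2" is "\<lambda>j z n. if n = j then z else 0"
proof -
  fix j :: int and z :: complex
  have "(\<lambda>n. (cmod (if n = j then z else 0))\<^sup>2) summable_on {j}" by simp
  then show "(\<lambda>n. (cmod (if n = j then z else 0))\<^sup>2) summable_on UNIV"
    by (rule summable_on_cong_neutral[THEN iffD1, rotated -1]) auto
qed

lemma ell2_nth_sum: "ell2_nth (\<Sum>i\<in>F. f i) n = (\<Sum>i\<in>F. ell2_nth (f i) n)"
  by (induction F rule: infinite_finite_induct) (simp_all add: zero_ell2.rep_eq plus_ell2.rep_eq)

text \<open>The square of the transform is computed on finitely supported sequences, where no exchange
  of conditionally convergent double series is needed; continuity and this expansion then carry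
  the result to the whole space.\<close>

lemma ell2_has_sum_singles: "((\<lambda>j. ell2_single j (ell2_nth a j)) has_sum a) UNIV"
proof -
  let ?s = "\<lambda>F. \<Sum>j\<in>F. ell2_single j (ell2_nth a j)"
  have norm_eq: "norm (?s F - a) = sqrt ((norm a)\<^sup>2 - (\<Sum>n\<in>F. (cmod (ell2_nth a n))\<^sup>2))"
    if F: "finite F" for F
  proof -
    have nth: "ell2_nth (?s F - a) n = (if n \<in> F then 0 else - ell2_nth a n)" for n
      using F by (simp add: minus_ell2.rep_eq ell2_nth_sum ell2_single.rep_eq)
    have "((\<lambda>n. (cmod (ell2_nth a n))\<^sup>2) has_sum (norm a)\<^sup>2) UNIV"
      unfolding norm_ell2_sq by (rule has_sum_infsum[OF ell2_summable_sq])
    then have "((\<lambda>n. (cmod (ell2_nth a n))\<^sup>2) has_sum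
        ((norm a)\<^sup>2 - (\<Sum>n\<in>F. (cmod (ell2_nth a n))\<^sup>2))) (UNIV - F)"
      by (rule has_sum_Diff[OF _ has_sum_finite[OF F]]) auto
    then have "((\<lambda>n. (cmod (ell2_nth (?s F - a) n))\<^sup>2) has_sum
        ((norm a)\<^sup>2 - (\<Sum>n\<in>F. (cmod (ell2_nth a n))\<^sup>2))) UNIV"
      by (rule has_sum_cong_neutral[THEN iffD1, rotated -1]) (auto simp: nth)
    then have "(norm (?s F - a))\<^sup>2 = (norm a)\<^sup>2 - (\<Sum>n\<in>F. (cmod (ell2_nth a n))\<^sup>2)"
      unfolding norm_ell2_sq[of "?s F - a"] by (rule infsumI)
    then show ?thesis by (metis norm_ge_zero real_sqrt_unique)
  qed
  have "((\<lambda>F. \<Sum>n\<in>F. (cmod (ell2_nth a n))\<^sup>2) \<longlongrightarrow> (norm a)\<^sup>2) (finite_subsets_at_top UNIV)"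
    unfolding norm_ell2_sq by (rule infsum_tendsto[OF ell2_summable_sq])
  then have "((\<lambda>F. sqrt ((norm a)\<^sup>2 - (\<Sum>n\<in>F. (cmod (ell2_nth a n))\<^sup>2)))
      \<longlongrightarrow> sqrt ((norm a)\<^sup>2 - (norm a)\<^sup>2)) (finite_subsets_at_top UNIV)"
    by (intro tendsto_intros)
  then have "((\<lambda>F. sqrt ((norm a)\<^sup>2 - (\<Sum>n\<in>F. (cmod (ell2_nth a n))\<^sup>2)))
      \<longlongrightarrow> 0) (finite_subsets_at_top UNIV)" by simp
  then have "((\<lambda>F. norm (?s F - a)) \<longlongrightarrow> 0) (finite_subsets_at_top UNIV)"
    by (rule Lim_transform_eventually)
       (auto intro!: eventually_finite_subsets_at_top_weakI simp: norm_eq)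
  then show ?thesis
    unfolding has_sum_def by (simp add: LIM_zero_cancel tendsto_norm_zero_iff)
qed

lemma kak_single: "ell2_nth (kak (ell2_single j z)) m = of_real (2 / pi * odd_recip (m - j)) * z"
proof -
  have "((\<lambda>n. ell2_nth (ell2_single j z) n * of_real (odd_recip (m - n)))
      has_sum (z * of_real (odd_recip (m - j)))) {j}"
    by (rule has_sum_finiteI) (simp_all add: ell2_single.rep_eq)
  then have "((\<lambda>n. ell2_nth (ell2_single j z) n * of_real (odd_recip (m - n)))
      has_sum (z * of_real (odd_recip (m - j)))) UNIV"
    by (rule has_sum_cong_neutral[THEN iffD1, rotated -1]) (auto simp: ell2_single.rep_eq)
  from infsumI[OF this] show ?thesis
    by (simp add: ell2_nth_kak kak_seq_eq)
qed

text \<open>The kernel is odd, so up to sign the entries of the squared matrix are the inner products of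
  its columns: these are orthogonal, and their norm is given by the value of \<^const>\<open>kak_const\<close>.\<close>

lemma kak_kak_single: "kak (kak (ell2_single j z)) = - ell2_single j z"
proof (rule ell2_eqI)
  fix m
  let ?c = "if j = m then kak_const else 0"
  have *: "((\<lambda>n. complex_of_real (odd_recip (n - j) * odd_recip (n - m))) has_sum of_real ?c) UNIV"
    by (rule has_sum_of_real[OF odd_recip_orth])
  have "((\<lambda>n. - of_real (2 / pi) * z * complex_of_real (odd_recip (n - j) * odd_recip (n - m)))
      has_sum (- of_real (2 / pi) * z * of_real ?c)) UNIV"
    by (rule has_sum_cmult_right[OF *])
  moreover have "- of_real (2 / pi) * z * complex_of_real (odd_recip (n - j) * odd_recip (n - m))
      = ell2_nth (kak (ell2_single j z)) n * of_real (odd_recip (m - n))" for n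
    using odd_recip_minus[of "n - m"] by (simp add: kak_single)
  ultimately have "((\<lambda>n. ell2_nth (kak (ell2_single j z)) n * of_real (odd_recip (m - n)))
      has_sum (- of_real (2 / pi) * z * of_real ?c)) UNIV" by simp
  from infsumI[OF this]
  show "ell2_nth (kak (kak (ell2_single j z))) m = ell2_nth (- ell2_single j z) m"
    by (subst ell2_nth_kak, subst kak_seq_eq)
       (simp add: uminus_ell2.rep_eq ell2_single.rep_eq kak_const_eq power2_eq_square)
qed

lemma kak_kak: "kak (kak a) = - a"
proof -
  have "((\<lambda>j. kak (ell2_single j (ell2_nth a j))) has_sum kak a) UNIV"
    by (rule has_sum_bounded_linear[OF blinfun.bounded_linear_right ell2_has_sum_singles])
  then have "((\<lambda>j. kak (kak (ell2_single j (ell2_nth a j)))) has_sum kak (kak a)) UNIV"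
    by (rule has_sum_bounded_linear[OF blinfun.bounded_linear_right])
  moreover have "((\<lambda>j. - ell2_single j (ell2_nth a j)) has_sum - a) UNIV"
    using ell2_has_sum_singles by (simp add: has_sum_uminus)
  ultimately show ?thesis
    unfolding kak_kak_single by (rule has_sum_unique)
qed

text \<open>Since the transform squares to \<open>-1\<close>, its exponential series splits into the cosine and sine
  series exactly as for the imaginary unit.\<close>

lemma exp_kak_eq: "exp_kak t a = cos t *\<^sub>R a + sin t *\<^sub>R kak a"
proof -
  have pow: "blinfun_apply ((((o\<^sub>L) kak) ^^ k) id_blinfun) a =
      (if even k then (- 1) ^ (k div 2) *\<^sub>R a else (- 1) ^ ((k - Suc 0) div 2) *\<^sub>R kak a)" for k
    by (induction k) (auto simp: kak_kak blinfun.scaleR_right elim!: evenE oddE)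
  have "(\<lambda>k. (t ^ k / fact k) *\<^sub>R blinfun_apply ((((o\<^sub>L) kak) ^^ k) id_blinfun) a) sums exp_kak t a"
    using bounded_linear.sums[OF blinfun.bounded_linear_left exp_kak_sums[of t], of a]
    by (simp add: blinfun.scaleR_left)
  moreover have "(t ^ k / fact k) *\<^sub>R blinfun_apply ((((o\<^sub>L) kak) ^^ k) id_blinfun) a
      = (cos_coeff k * t ^ k) *\<^sub>R a + (sin_coeff k * t ^ k) *\<^sub>R kak a" for k
    by (simp add: pow cos_coeff_def sin_coeff_def)
  moreover have "(\<lambda>k. (cos_coeff k * t ^ k) *\<^sub>R a + (sin_coeff k * t ^ k) *\<^sub>R kak a)
      sums (cos t *\<^sub>R a + sin t *\<^sub>R kak a)"
    using cos_converges[of t] sin_converges[of t]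
    by (intro sums_add bounded_linear.sums[OF bounded_linear_scaleR_left]) simp_all
  ultimately show ?thesis by (simp add: sums_unique2)
qed

section \<open>Bilateral sums and shifted cardinal sines\<close>

text \<open>Every unordered sum is a bilateral one, and limits that are uniform along finite sets of
  indices stay uniform along the truncations.\<close>

lemma filterlim_bilateral_truncation:
  "filterlim (\<lambda>(M, N). A \<inter> {- int M..int N}) (finite_subsets_at_top A)
      (sequentially \<times>\<^sub>F sequentially)"
  unfolding filterlim_finite_subsets_at_top
proof safe
  fix X assume X: "finite X" "X \<subseteq> A"
  obtain k where k: "\<And>x. x \<in> X \<Longrightarrow> \<bar>x\<bar> \<le> int k"
  proof -
    have "\<bar>x\<bar> \<le> int (nat (Max (insert 0 (abs ` X))))" if "x \<in> X" for x
      using X that by (simp add: le_nat_iff)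
    then show thesis by (rule that)
  qed
  have "\<forall>\<^sub>F M in sequentially. M \<ge> k" by (rule eventually_ge_at_top)
  then show "\<forall>\<^sub>F MN in sequentially \<times>\<^sub>F sequentially.
      finite (case MN of (M, N) \<Rightarrow> A \<inter> {- int M..int N}) \<and>
      X \<subseteq> (case MN of (M, N) \<Rightarrow> A \<inter> {- int M..int N}) \<and>
      (case MN of (M, N) \<Rightarrow> A \<inter> {- int M..int N}) \<subseteq> A"
    unfolding eventually_prod_filter
  proof (intro exI conjI allI impI)
    fix M N assume "k \<le> M" "k \<le> N"
    then have "X \<subseteq> A \<inter> {- int M..int N}" using X k by fastforce
    then show "finite (case (M, N) of (M, N) \<Rightarrow> A \<inter> {- int M..int N})"
      "X \<subseteq> (case (M, N) of (M, N) \<Rightarrow> A \<inter> {- int M..int N})"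
      "(case (M, N) of (M, N) \<Rightarrow> A \<inter> {- int M..int N}) \<subseteq> A"
      by auto
  qed
qed

lemma bilateral_sum_eq: "bilateral_sum f A =
    (\<lambda>MN. \<Sum>n\<in>(case MN of (M, N) \<Rightarrow> A \<inter> {- int M..int N}). f n)"
  by (auto simp: bilateral_sum_def)

lemma has_sum_imp_has_bilateral_sum:
  assumes "(f has_sum s) A"
  shows "has_bilateral_sum f A s"
  using filterlim_compose[OF assms[unfolded has_sum_def] filterlim_bilateral_truncation[of A]]
  by (simp add: has_bilateral_sum_def bilateral_sum_eq)

lemma sin_pi_shift: "sin (pi * (x - of_int n)) = cos (pi * of_int n) * sin (pi * x)"
  by (simp only: right_diff_distrib sin_diff sin_npi_int) simp

text \<open>The sign is written as \<open>cos (pi * n)\<close>, the value at the node of the function that is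
  interpolated later on.\<close>

lemma sinc_shift_mult: "(x - of_int n) * sinc (x - of_int n) =
    cos (pi * of_int n) * sin (pi * x) / pi"
proof -
  have "pi * ((x - of_int n) * sinc (x - of_int n)) = sin (pi * (x - of_int n))"
    by (simp add: sinc_def)
  then show ?thesis unfolding sin_pi_shift by (simp add: field_simps del: cos_npi_int)
qed

lemma sinc_of_int: "sinc (of_int m) = (if m = 0 then 1 else 0)"
  by (simp add: sinc_def)

lemma abs_sinc_le_1: "\<bar>sinc t\<bar> \<le> 1"
  using abs_sin_x_le_abs_x[of "pi * t"] by (simp add: sinc_def divide_simps)

text \<open>From \<open>n = x - (x - n)\<close>: the first part is controlled by the boundedness of the cardinal
  sine, the second by that of the sine.\<close>

lemma abs_of_int_mult_sinc_le: "\<bar>of_int n * sinc (x - of_int n)\<bar> \<le> \<bar>x\<bar> + 1"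
proof -
  have "of_int n * sinc (x - of_int n) =
      x * sinc (x - of_int n) - cos (pi * of_int n) * sin (pi * x) / pi"
    unfolding sinc_shift_mult[symmetric] by (simp add: algebra_simps)
  moreover have "\<bar>x * sinc (x - of_int n)\<bar> \<le> \<bar>x\<bar>"
    using mult_left_mono[OF abs_sinc_le_1] by (fastforce simp: abs_mult)
  moreover have "\<bar>cos (pi * of_int n) * sin (pi * x) / pi\<bar> \<le> 1"
  proof -
    have "\<bar>cos (pi * of_int n) * sin (pi * x)\<bar> \<le> 1 * 1"
      unfolding abs_mult by (intro mult_mono abs_cos_le_one abs_sin_le_one) auto
    then show ?thesis using pi_gt3 by (simp add: abs_divide divide_simps del: cos_npi_int)
  qed
  ultimately show ?thesis by linarith
qed

text \<open>The factor \<open>x / n\<close> gains one order of decay in \<open>n\<close>, which makes the regularised series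
  converge absolutely and locally uniformly in \<open>x\<close>.\<close>

lemma abs_regularized_sinc_le: "\<bar>x / of_int n * sinc (x - of_int n)\<bar> \<le>
    \<bar>x\<bar> * (\<bar>x\<bar> + 1) * (1 / (of_int n)\<^sup>2)"
proof (cases "n = 0")
  case False
  have "\<bar>x / of_int n * sinc (x - of_int n)\<bar> =
      \<bar>x\<bar> * (1 / (of_int n)\<^sup>2) * \<bar>of_int n * sinc (x - of_int n)\<bar>"
    using False by (simp add: abs_mult abs_divide power2_eq_square)
       (simp add: divide_simps)
  also have "\<dots> \<le> \<bar>x\<bar> * (1 / (of_int n)\<^sup>2) * (\<bar>x\<bar> + 1)"
    by (intro mult_left_mono abs_of_int_mult_sinc_le) simp
  finally show ?thesis by (simp add: algebra_simps)
qed simp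

text \<open>The bridge between the plain and the regularised series: they differ by a series that
  depends on \<open>x\<close> only through the factor \<open>sin (pi * x)\<close>. It comes from \<open>x / n = (x - n) / n + 1\<close>.\<close>

lemma regularized_sinc_split:
  assumes "n \<noteq> 0"
  shows "x / of_int n * sinc (x - of_int n) =
    sinc (x - of_int n) + sin (pi * x) / pi * (cos (pi * of_int n) / of_int n)"
proof -
  have "x / of_int n * sinc (x - of_int n) =
    (x - of_int n) * sinc (x - of_int n) / of_int n + sinc (x - of_int n)"
    using assms by (simp add: divide_simps) (simp add: algebra_simps)
  then show ?thesis unfolding sinc_shift_mult by simp
qed

section \<open>Interpolation of the constant and of the cosine at the integers\<close>

text \<open>Logarithmic differentiation of Euler's reflection formula expresses the cotangent as the
  difference of two values of the digamma function. In the limit formulas of these values the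
  logarithms cancel, and the two remaining sums are the two halves of the partial fraction
  expansion; the first one starts at the pole \<open>0\<close>, the second one at the pole \<open>1\<close>, hence the
  window of indices is off centre by one.\<close>

lemma cot_partial_fractions:
  fixes x :: real
  assumes "x \<notin> \<int>"
  shows "(\<lambda>m. \<Sum>k\<in>{1 - int m..int m}. 1 / (x - of_int k)) \<longlonglongrightarrow> pi * cos (pi * x) / sin (pi * x)"
proof -
  have reflection: "rGamma y * rGamma (1 - y) = sin (pi * y) / pi" for y :: real
  proof -
    have "complex_of_real (rGamma y * rGamma (1 - y)) = complex_of_real (sin (pi * y) / pi)"
      using rGamma_reflection_complex[of "of_real y"]
      by (simp add: rGamma_complex_of_real[symmetric] sin_of_real[symmetric])
    then show ?thesis by (simp only: of_real_eq_iff)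
  qed
  have nonint: "x \<notin> \<int>\<^sub>\<le>\<^sub>0" "1 - x \<notin> \<int>\<^sub>\<le>\<^sub>0"
    using assms nonpos_Ints_Int Ints_diff[OF Ints_1, of "1 - x"] by auto
  have "((\<lambda>y. rGamma y * rGamma (1 - y)) has_field_derivative
      (rGamma x * rGamma (1 - x)) * (Digamma (1 - x) - Digamma x)) (at x)"
    using nonint by (auto intro!: derivative_eq_intros DERIV_chain2[where f = rGamma]
        has_field_derivative_rGamma_no_nonpos_int simp: algebra_simps)
  moreover have "((\<lambda>y. sin (pi * y) / pi) has_field_derivative cos (pi * x)) (at x)"
    by (auto intro!: derivative_eq_intros)
  ultimately have "(rGamma x * rGamma (1 - x)) * (Digamma (1 - x) - Digamma x) = cos (pi * x)"
    unfolding reflection by (rule DERIV_unique)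
  moreover have "sin (pi * x) \<noteq> 0"
    using assms sin_times_pi_eq_0[of x] by (simp add: mult.commute)
  ultimately have cot: "Digamma (1 - x) - Digamma x = pi * cos (pi * x) / sin (pi * x)"
    unfolding reflection by (simp add: field_simps)
  have "(\<lambda>m. (of_real (ln (real m)) - (\<Sum>n<m. inverse ((1 - x) + real n)))
      - (of_real (ln (real m)) - (\<Sum>n<m. inverse (x + real n)))) \<longlonglongrightarrow> Digamma (1 - x) - Digamma x"
    using assms by (intro tendsto_diff Digamma_LIMSEQ) auto
  moreover have "(of_real (ln (real m)) - (\<Sum>n<m. inverse ((1 - x) + real n)))
      - (of_real (ln (real m)) - (\<Sum>n<m. inverse (x + real n)))
      = (\<Sum>k\<in>{1 - int m..int m}. 1 / (x - of_int k))" for m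
  proof (induction m)
    case (Suc m)
    have "{1 - int (Suc m)..int (Suc m)} = insert (- int m) (insert (int m + 1) {1 - int m..int m})"
      by auto
    then have "(\<Sum>k\<in>{1 - int (Suc m)..int (Suc m)}. 1 / (x - of_int k))
        = 1 / (x + real m) + (1 / (x - (real m + 1)) + (\<Sum>k\<in>{1 - int m..int m}. 1 / (x - of_int k)))"
      by simp
    moreover have "1 / (x - (real m + 1)) = - inverse ((1 - x) + real m)"
      by (simp add: divide_inverse flip: inverse_minus_eq)
    ultimately show ?case using Suc by (simp add: divide_inverse)
  qed simp
  ultimately show ?thesis unfolding cot by simp
qed

text \<open>By \<open>1 / sin (2 * u) = (cos u / sin u) - (cos (2 * u) / sin (2 * u))\<close>: halving the argument
  doubles the terms at the even poles, and the subtraction turns their coefficients \<open>2\<close> and \<open>0\<close>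
  into \<open>1\<close> and \<open>-1\<close>.\<close>

lemma csc_partial_fractions:
  fixes x :: real
  assumes x: "x \<notin> \<int>"
  shows "(\<lambda>m. \<Sum>k\<in>{1 - 2 * int m..2 * int m}. cos (pi * of_int k) / (x - of_int k))
      \<longlonglongrightarrow> pi / sin (pi * x)"
proof -
  let ?c = "\<lambda>x m. \<Sum>k\<in>{1 - int m..int m}. 1 / (x - of_int k :: real)"
  have half: "x / 2 \<notin> \<int>"
  proof
    assume "x / 2 \<in> \<int>"
    then have "2 * (x / 2) \<in> \<int>" by (intro Ints_mult) auto
    with x show False by simp
  qed
  have "(\<lambda>m. ?c x (2 * m)) \<longlonglongrightarrow> pi * cos (pi * x) / sin (pi * x)"
    by (rule filterlim_compose[OF cot_partial_fractions[OF x]]) (rule mult_nat_left_at_top, simp)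
  then have "(\<lambda>m. ?c (x / 2) m - ?c x (2 * m)) \<longlonglongrightarrow>
      pi * cos (pi * (x / 2)) / sin (pi * (x / 2)) - pi * cos (pi * x) / sin (pi * x)"
    by (intro tendsto_diff cot_partial_fractions[OF half])
  moreover have "?c (x / 2) m - ?c x (2 * m) =
      (\<Sum>k\<in>{1 - 2 * int m..2 * int m}. cos (pi * of_int k) / (x - of_int k))" for m
  proof (induction m)
    case (Suc m)
    have 1: "{1 - int (Suc m)..int (Suc m)} =
        insert (- int m) (insert (int m + 1) {1 - int m..int m})"
      by auto
    have 2: "{1 - 2 * int (Suc m)..2 * int (Suc m)} = insert (- 2 * int m - 1) (insert (- 2 * int m)
        (insert (2 * int m + 1) (insert (2 * int m + 2) {1 - 2 * int m..2 * int m})))"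
      by auto
    have "1 / (x / 2 - real_of_int (int m + 1)) = 2 / (x - real_of_int (2 * int m + 2))"
      "1 / (x / 2 - real_of_int (- int m)) = 2 / (x - real_of_int (- 2 * int m))"
      by (simp_all add: field_simps)
    then show ?case using Suc unfolding of_nat_mult of_nat_numeral 1 2
      by (simp add: cos_npi_int del: of_int_add of_int_diff of_int_minus of_int_mult)
  qed simp
  moreover have "pi * cos (pi * (x / 2)) / sin (pi * (x / 2)) - pi * cos (pi * x) / sin (pi * x) =
      pi / sin (pi * x)"
  proof -
    have "sin (pi * (x / 2)) \<noteq> 0" "sin (pi * x) \<noteq> 0"
      using x half sin_times_pi_eq_0[of x] sin_times_pi_eq_0[of "x / 2"]
          by (auto simp: mult.commute)
    moreover have "sin (pi * x) = 2 * sin (pi * (x / 2)) * cos (pi * (x / 2))"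
      "cos (pi * x) = 2 * (cos (pi * (x / 2)))\<^sup>2 - 1"
      using sin_double[of "pi * (x / 2)"] cos_double_cos[of "pi * (x / 2)"] by simp_all
    ultimately show ?thesis by (simp add: divide_simps power2_eq_square) (simp add: algebra_simps)
  qed
  ultimately show ?thesis by simp
qed

text \<open>At the integers the series reduces to a single term. Elsewhere it is the cotangent expansion
  multiplied by \<open>sin (pi * x) / pi\<close>.\<close>

lemma cosine_sampling_limit:
  "(\<lambda>m. \<Sum>k\<in>{1 - int m..int m}. cos (pi * of_int k) * sinc (x - of_int k)) \<longlonglongrightarrow> cos (pi * x)"
proof (cases "x \<in> \<int>")
  case True
  then obtain j where j: "x = of_int j" by (rule Ints_cases)
  have "\<forall>\<^sub>F m in sequentially. (\<Sum>k\<in>{1 - int m..int m}. cos (pi * of_int k) * sinc (x - of_int k))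
      = cos (pi * x)"
    using eventually_gt_at_top[of "nat \<bar>j\<bar>"]
  proof eventually_elim
    case (elim m)
    have "(\<Sum>k\<in>{1 - int m..int m}. cos (pi * of_int k) * sinc (x - of_int k))
        = (\<Sum>k\<in>{1 - int m..int m}. if k = j then cos (pi * x) else 0)"
      by (intro sum.cong refl) (auto simp: j sinc_of_int simp flip: of_int_diff)
    moreover have "j \<in> {1 - int m..int m}" using elim by auto
    ultimately show ?case by simp
  qed
  then show ?thesis by (rule tendsto_eventually)
next
  case False
  have "(\<lambda>m. sin (pi * x) / pi * (\<Sum>k\<in>{1 - int m..int m}. 1 / (x - of_int k)))
      \<longlonglongrightarrow> sin (pi * x) / pi * (pi * cos (pi * x) / sin (pi * x))"
    by (intro tendsto_mult tendsto_const cot_partial_fractions False)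
  moreover have "sin (pi * x) / pi * (1 / (x - of_int k)) =
      cos (pi * of_int k) * sinc (x - of_int k)" for k
  proof -
    have "x \<noteq> of_int k" using False by auto
    then show ?thesis using sinc_shift_mult[of x k] by (auto simp: field_simps split: if_splits)
  qed
  ultimately show ?thesis
    using False sin_times_pi_eq_0[of x] by (simp add: sum_distrib_left mult.commute)
qed

text \<open>The same argument with the cosecant in place of the cotangent.\<close>

lemma constant_sampling_limit:
  "(\<lambda>m. \<Sum>k\<in>{1 - 2 * int m..2 * int m}. sinc (x - of_int k)) \<longlonglongrightarrow> 1"
proof (cases "x \<in> \<int>")
  case True
  then obtain j where j: "x = of_int j" by (rule Ints_cases)
  have "\<forall>\<^sub>F m in sequentially. (\<Sum>k\<in>{1 - 2 * int m..2 * int m}. sinc (x - of_int k)) = 1"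
    using eventually_gt_at_top[of "nat \<bar>j\<bar>"]
  proof eventually_elim
    case (elim m)
    have "(\<Sum>k\<in>{1 - 2 * int m..2 * int m}. sinc (x - of_int k))
        = (\<Sum>k\<in>{1 - 2 * int m..2 * int m}. if k = j then 1 else 0)"
      by (intro sum.cong refl) (auto simp: j sinc_of_int simp flip: of_int_diff)
    moreover have "j \<in> {1 - 2 * int m..2 * int m}" using elim by auto
    ultimately show ?case by simp
  qed
  then show ?thesis by (rule tendsto_eventually)
next
  case False
  have "(\<lambda>m. sin (pi * x) / pi * (\<Sum>k\<in>{1 - 2 * int m..2 * int m}.
      cos (pi * of_int k) / (x - of_int k)))
      \<longlonglongrightarrow> sin (pi * x) / pi * (pi / sin (pi * x))"
    by (intro tendsto_mult tendsto_const csc_partial_fractions False)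
  moreover have "sin (pi * x) / pi * (cos (pi * of_int k) / (x - of_int k)) = sinc (x - of_int k)"
      for k
  proof -
    have "x \<noteq> of_int k" using False by auto
    then show ?thesis using sinc_shift_mult[of x k] by (auto simp: field_simps split: if_splits)
  qed
  ultimately show ?thesis
    using False sin_times_pi_eq_0[of x] by (simp add: sum_distrib_left mult.commute)
qed

text \<open>The terms at \<open>n\<close> and \<open>-n\<close> cancel, so that only the unpaired index at the right end of the
  window remains.\<close>

lemma sum_even_over_int:
  fixes g :: "int \<Rightarrow> real"
  assumes "\<And>n. g (- n) = g n"
  shows "(\<Sum>n\<in>{1 - int m..int m} - {0}. g n / of_int n) = g (int m) / real m"
proof (induction m)
  case (Suc m)
  show ?case
  proof (cases "m = 0")
    case True
    then have "{1 - int (Suc m)..int (Suc m)} - {0} = {1}" by auto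
    with True show ?thesis by simp
  next
    case False
    then have "{1 - int (Suc m)..int (Suc m)} - {0} =
        insert (- int m) (insert (int (Suc m)) ({1 - int m..int m} - {0}))" by auto
    with False Suc show ?thesis by (simp add: assms)
  qed
qed simp

lemma summable_on_regularized_sinc:
  assumes "\<And>n. \<bar>g n\<bar> \<le> 1"
  shows "(\<lambda>n. x / of_int n * (g n * sinc (x - of_int n))) summable_on (UNIV - {0})"
proof (rule abs_summable_summable, rule Infinite_Sum.abs_summable_on_comparison_test')
  show "(\<lambda>n::int. \<bar>x\<bar> * (\<bar>x\<bar> + 1) * (1 / (of_int n)\<^sup>2)) summable_on (UNIV - {0})"
    by (intro summable_on_cmult_right has_sum_imp_summable[OF has_sum_inverse_square_int])
  fix n :: int
  have "norm (x / of_int n * (g n * sinc (x - of_int n))) =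
      \<bar>g n\<bar> * \<bar>x / of_int n * sinc (x - of_int n)\<bar>"
    by (simp add: abs_mult)
  also have "\<dots> \<le> 1 * (\<bar>x\<bar> * (\<bar>x\<bar> + 1) * (1 / (of_int n)\<^sup>2))"
    by (intro mult_mono assms abs_regularized_sinc_le) auto
  finally show "norm (x / of_int n * (g n * sinc (x - of_int n))) \<le>
      \<bar>x\<bar> * (\<bar>x\<bar> + 1) * (1 / (of_int n)\<^sup>2)" by simp
qed

text \<open>The sum of an absolutely convergent series may be computed along any exhausting sequence of
  windows, so a limit of the plain series along one such sequence is enough. For even \<open>g\<close> the
  correction from \<open>regularized_sinc_split\<close> is an odd series; it leaves a single boundary term,
  which tends to zero.\<close>

lemma regularized_sinc_has_sum:
  fixes g :: "int \<Rightarrow> real" and r :: "nat \<Rightarrow> nat"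
  assumes even: "\<And>n. g (- n) = g n" and bound: "\<And>n. \<bar>g n\<bar> \<le> 1"
    and r: "filterlim r at_top sequentially"
    and lim: "(\<lambda>m. \<Sum>k\<in>{1 - int (r m)..int (r m)}. g k * sinc (x - of_int k)) \<longlonglongrightarrow> L"
  shows "((\<lambda>n. x / of_int n * (g n * sinc (x - of_int n))) has_sum (L - g 0 * sinc x)) (UNIV - {0})"
proof -
  let ?f = "\<lambda>n. x / of_int n * (g n * sinc (x - of_int n))"
  let ?A = "\<lambda>m. {1 - int m..int m} - {0}"
  let ?h = "\<lambda>n. g n * cos (pi * of_int n)"
  have "filterlim (\<lambda>m. ?A (r m)) (finite_subsets_at_top (UNIV - {0})) sequentially"
    unfolding filterlim_finite_subsets_at_top
  proof safe
    fix X :: "int set" assume X: "finite X" "X \<subseteq> UNIV - {0}"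
    have "\<forall>\<^sub>F m in sequentially. r m > nat (Max (insert 0 (abs ` X)))"
      by (rule eventually_compose_filterlim[OF eventually_gt_at_top r])
    then show "\<forall>\<^sub>F m in sequentially. finite (?A (r m)) \<and> X \<subseteq> ?A (r m) \<and> ?A (r m) \<subseteq> UNIV - {0}"
    proof eventually_elim
      case (elim m)
      have "\<bar>x\<bar> < int (r m)" if "x \<in> X" for x
      proof -
        have "\<bar>x\<bar> \<le> Max (insert 0 (abs ` X))" using X that by simp
        with elim show ?thesis by linarith
      qed
      then show ?case using X by fastforce
    qed
  qed
  moreover have hs: "(?f has_sum infsum ?f (UNIV - {0})) (UNIV - {0})"
    by (rule has_sum_infsum[OF summable_on_regularized_sinc[OF bound]])
  ultimately have "(\<lambda>m. sum ?f (?A (r m))) \<longlonglongrightarrow> infsum ?f (UNIV - {0})"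
    unfolding has_sum_def by (rule filterlim_compose[rotated])
  moreover have "(\<lambda>m. sum ?f (?A (r m))) \<longlonglongrightarrow> L - g 0 * sinc x"
  proof -
    have "(\<lambda>n. ?h (int n) / real n) \<longlonglongrightarrow> 0"
    proof (rule Lim_null_comparison)
      show "\<forall>\<^sub>F n in sequentially. norm (?h (int n) / real n) \<le> 1 / real n"
        using bound by (intro always_eventually allI) (auto simp: abs_mult divide_right_mono)
    qed (rule lim_1_over_n)
    from filterlim_compose[OF this r]
    have "(\<lambda>m. (\<Sum>k\<in>{1 - int (r m)..int (r m)}. g k * sinc (x - of_int k)) - g 0 * sinc x
        + sin (pi * x) / pi * (?h (int (r m)) / real (r m))) \<longlonglongrightarrow> L - g 0 * sinc x
            + sin (pi * x) / pi * 0"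
      by (intro tendsto_intros lim)
    then have "(\<lambda>m. (\<Sum>k\<in>{1 - int (r m)..int (r m)}. g k * sinc (x - of_int k)) - g 0 * sinc x
        + sin (pi * x) / pi * (?h (int (r m)) / real (r m))) \<longlonglongrightarrow> L - g 0 * sinc x" by simp
    then show ?thesis
    proof (rule Lim_transform_eventually)
      have "\<forall>\<^sub>F m in sequentially. r m > 0"
          by (rule eventually_compose_filterlim[OF eventually_gt_at_top r])
      then show "\<forall>\<^sub>F m in sequentially.
          (\<Sum>k\<in>{1 - int (r m)..int (r m)}. g k * sinc (x - of_int k)) - g 0 * sinc x
          + sin (pi * x) / pi * (?h (int (r m)) / real (r m)) = sum ?f (?A (r m))"
      proof eventually_elim
        case (elim m)
        have "sum ?f (?A (r m)) =
            (\<Sum>n\<in>?A (r m). g n * sinc (x - of_int n) + sin (pi * x) / pi * (?h n / of_int n))"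
        proof (intro sum.cong refl)
          fix n assume "n \<in> ?A (r m)"
          then have "n \<noteq> 0" by simp
          have "?f n = g n * (x / of_int n * sinc (x - of_int n))" by simp
          also note regularized_sinc_split[OF \<open>n \<noteq> 0\<close>]
          finally show "?f n = g n * sinc (x - of_int n) + sin (pi * x) / pi * (?h n / of_int n)"
            by (simp add: algebra_simps del: cos_npi_int)
        qed
        also have "\<dots> = (\<Sum>n\<in>?A (r m). g n * sinc (x - of_int n))
            + sin (pi * x) / pi * (\<Sum>n\<in>?A (r m). ?h n / of_int n)"
          by (simp only: sum.distrib sum_distrib_left)
        also have "(\<Sum>n\<in>?A (r m). ?h n / of_int n) = ?h (int (r m)) / real (r m)"
          by (rule sum_even_over_int) (simp add: even)
        also have "(\<Sum>n\<in>?A (r m). g n * sinc (x - of_int n)) =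
            (\<Sum>k\<in>{1 - int (r m)..int (r m)}. g k * sinc (x - of_int k)) - g 0 * sinc x"
          using elim by (simp add: sum_diff1)
        finally show ?case ..
      qed
    qed
  qed
  ultimately have "infsum ?f (UNIV - {0}) = L - g 0 * sinc x" by (rule LIMSEQ_unique)
  with hs show ?thesis by (rule back_subst)
qed

lemma constant_has_sum_regularized:
  "((\<lambda>n. x / of_int n * sinc (x - of_int n)) has_sum (1 - sinc x)) (UNIV - {0})"
  using regularized_sinc_has_sum[of "\<lambda>_. 1" "\<lambda>m. 2 * m" x 1] constant_sampling_limit[of x]
  by (simp add: mult_nat_left_at_top)

lemma cosine_has_sum_regularized:
  "((\<lambda>n. x / of_int n * (cos (pi * of_int n) * sinc (x - of_int n)))
      has_sum (cos (pi * x) - sinc x)) (UNIV - {0})"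
  using regularized_sinc_has_sum[of "\<lambda>n. cos (pi * of_int n)" "\<lambda>m. m" x "cos (pi * x)"]
      cosine_sampling_limit[of x]
  by (simp add: filterlim_ident)

section \<open>Uniform convergence of the sampling series of exponentials\<close>

text \<open>Both halves of the series converge by Leibniz' criterion, to opposite limits. Hence the
  truncation bounds may grow independently of each other.\<close>

lemma alternating_harmonic_bilateral:
  "((\<lambda>(M, N). \<Sum>n\<in>(UNIV - {0}) \<inter> {- int M..int N}. cos (pi * of_int n) / of_int n) \<longlongrightarrow> 0)
    (sequentially \<times>\<^sub>F sequentially)"
proof -
  let ?a = "\<lambda>k. (-1) ^ k * (1 / real (Suc k))"
  have "summable ?a"
    by (rule summable_Leibniz(1)) (auto simp:
        LIMSEQ_inverse_real_of_nat[unfolded inverse_eq_divide] monoseq_def frac_le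
        simp del: of_nat_Suc)
  then have lim: "(\<lambda>N. \<Sum>k<N. ?a k) \<longlonglongrightarrow> suminf ?a" by (rule summable_LIMSEQ)
  have "((\<lambda>MN. (\<Sum>k<fst MN. ?a k) - (\<Sum>k<snd MN. ?a k)) \<longlongrightarrow> suminf ?a - suminf ?a)
      (sequentially \<times>\<^sub>F sequentially)"
    by (intro tendsto_diff filterlim_compose[OF lim] filterlim_fst filterlim_snd)
  moreover have "(\<Sum>k<M. ?a k) - (\<Sum>k<N. ?a k) =
      (\<Sum>n\<in>(UNIV - {0}) \<inter> {- int M..int N}. cos (pi * of_int n) / of_int n)" for M N
  proof (induction N)
    case 0
    show ?case
    proof (induction M)
      case (Suc M)
      have "(UNIV - {0}) \<inter> {- int (Suc M)..int 0} =
          insert (- int (Suc M)) ((UNIV - {0}) \<inter> {- int M..int 0})"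
        by auto
      moreover have "cos (pi * of_int (- int (Suc M))) / of_int (- int (Suc M)) = ?a M"
        unfolding cos_npi_int by (simp add: divide_simps)
      ultimately show ?case using Suc by (simp del: cos_npi_int of_nat_Suc)
    qed simp
  next
    case (Suc N)
    have "(UNIV - {0}) \<inter> {- int M..int (Suc N)} =
        insert (int (Suc N)) ((UNIV - {0}) \<inter> {- int M..int N})"
      by auto
    moreover have "cos (pi * of_int (int (Suc N))) / of_int (int (Suc N)) = - ?a N"
      unfolding cos_npi_int by (simp add: divide_simps)
    ultimately show ?case using Suc by (simp del: cos_npi_int of_nat_Suc)
  qed
  ultimately show ?thesis by (simp add: case_prod_unfold)
qed

text \<open>Absolute convergence of the regularised series gives uniformity by the Weierstrass test; the
  plain series differs from it by \<open>sin (pi * x) / pi\<close> times the alternating harmonic series.\<close>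

lemma uniform_limit_sinc_partition_of_unity:
  assumes "bounded X"
  shows "uniform_limit X
      (\<lambda>MN x. bilateral_sum (\<lambda>n. sinc (x - of_int n)) UNIV MN) (\<lambda>_. 1)
      (sequentially \<times>\<^sub>F sequentially)"
proof -
  obtain R where R: "\<And>x. x \<in> X \<Longrightarrow> \<bar>x\<bar> \<le> R" using assms by (auto simp: bounded_iff)
  let ?A = "\<lambda>MN. case MN of (M, N) \<Rightarrow> (UNIV - {0}) \<inter> {- int M..int N}"
  have "uniform_limit X (\<lambda>F x. \<Sum>n\<in>F. x / of_int n * sinc (x - of_int n)) (\<lambda>x. 1 - sinc x)
      (finite_subsets_at_top (UNIV - {0}))"
  proof (rule Weierstrass_m_test_general')
    show "(\<lambda>n::int. R * (R + 1) * (1 / (of_int n)\<^sup>2)) summable_on (UNIV - {0})"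
      by (intro summable_on_cmult_right has_sum_imp_summable[OF has_sum_inverse_square_int])
    fix n :: int and x assume x: "x \<in> X"
    have "norm (x / of_int n * sinc (x - of_int n)) \<le> \<bar>x\<bar> * (\<bar>x\<bar> + 1) * (1 / (of_int n)\<^sup>2)"
      using abs_regularized_sinc_le[of x n] by simp
    also have "\<dots> \<le> R * (R + 1) * (1 / (of_int n)\<^sup>2)"
      using R[OF x] by (intro mult_right_mono mult_mono) auto
    finally show "norm (x / of_int n * sinc (x - of_int n)) \<le> R * (R + 1) * (1 / (of_int n)\<^sup>2)" .
  qed (rule constant_has_sum_regularized)
  from filterlim_compose[OF this filterlim_bilateral_truncation[of "UNIV - {0}"]]
  have reg: "uniform_limit X (\<lambda>MN x. \<Sum>n\<in>?A MN. x / of_int n * sinc (x - of_int n)) (\<lambda>x. 1 - sinc x)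
      (sequentially \<times>\<^sub>F sequentially)" .
  have alt: "uniform_limit X
      (\<lambda>MN x. sin (pi * x) / pi * (\<Sum>n\<in>?A MN. cos (pi * of_int n) / of_int n)) (\<lambda>_. 0)
      (sequentially \<times>\<^sub>F sequentially)"
  proof (rule uniform_limitI)
    fix e :: real assume "0 < e"
    from tendstoD[OF alternating_harmonic_bilateral this]
    have "\<forall>\<^sub>F MN in sequentially \<times>\<^sub>F sequentially. \<bar>\<Sum>n\<in>?A MN. cos (pi * of_int n) / of_int n\<bar> < e"
      by (simp add: case_prod_beta dist_norm del: cos_npi_int)
    then show "\<forall>\<^sub>F MN in sequentially \<times>\<^sub>F sequentially. \<forall>x\<in>X.
        dist (sin (pi * x) / pi * (\<Sum>n\<in>?A MN. cos (pi * of_int n) / of_int n)) 0 < e"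
    proof eventually_elim
      case (elim MN)
      show ?case
      proof
        fix x
        have "\<bar>sin (pi * x) / pi\<bar> \<le> 1"
          using abs_sin_le_one[of "pi * x"] pi_gt3
              by (simp add: abs_divide divide_simps del: abs_sin_le_one)
        then have "\<bar>sin (pi * x) / pi * (\<Sum>n\<in>?A MN. cos (pi * of_int n) / of_int n)\<bar>
            \<le> 1 * \<bar>\<Sum>n\<in>?A MN. cos (pi * of_int n) / of_int n\<bar>"
          unfolding abs_mult by (intro mult_right_mono) auto
        then show "dist (sin (pi * x) / pi * (\<Sum>n\<in>?A MN. cos (pi * of_int n) / of_int n)) 0 < e"
          using elim by (simp only: dist_norm real_norm_def diff_zero)
      qed
    qed
  qed
  have "uniform_limit X (\<lambda>MN x. sinc x + ((\<Sum>n\<in>?A MN. x / of_int n * sinc (x - of_int n))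
      - sin (pi * x) / pi * (\<Sum>n\<in>?A MN. cos (pi * of_int n) / of_int n)))
          (\<lambda>x. sinc x + ((1 - sinc x) - 0))
      (sequentially \<times>\<^sub>F sequentially)"
    by (intro uniform_limit_add uniform_limit_minus reg alt) (auto intro!: uniform_limitI)
  moreover have "sinc x + ((\<Sum>n\<in>?A MN. x / of_int n * sinc (x - of_int n))
      - sin (pi * x) / pi * (\<Sum>n\<in>?A MN. cos (pi * of_int n) / of_int n))
      = bilateral_sum (\<lambda>n. sinc (x - of_int n)) UNIV MN" for MN x
  proof (cases MN)
    case (Pair M N)
    have "(\<Sum>n\<in>?A MN. x / of_int n * sinc (x - of_int n)) =
        (\<Sum>n\<in>?A MN. sinc (x - of_int n) + sin (pi * x) / pi * (cos (pi * of_int n) / of_int n))"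
      by (intro sum.cong refl regularized_sinc_split) (auto simp: Pair)
    also have "\<dots> = (\<Sum>n\<in>?A MN. sinc (x - of_int n))
        + sin (pi * x) / pi * (\<Sum>n\<in>?A MN. cos (pi * of_int n) / of_int n)"
      by (simp only: sum.distrib sum_distrib_left)
    also have "(\<Sum>n\<in>?A MN. sinc (x - of_int n)) =
        bilateral_sum (\<lambda>n. sinc (x - of_int n)) UNIV MN - sinc x"
    proof -
      have "(UNIV - {0}) \<inter> {- int M..int N} = {- int M..int N} - {0}" by auto
      then show ?thesis by (simp add: Pair bilateral_sum_def sum_diff1)
    qed
    finally show ?thesis by (simp del: cos_npi_int)
  qed
  ultimately show ?thesis by simp
qed

text \<open>An integration by parts without integrals. With \<open>e\<close> a primitive of the oscillating factor,
  which is small of order \<open>1 / \<bar>p\<bar> + 1 / \<bar>q\<bar>\<close>, the derivative of \<open>G\<close> is \<open>\<phi> e'\<close>; hence \<open>G - \<phi> e\<close>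
  has derivative \<open>- \<phi>' e\<close>, which is small as well, and the mean value inequality applies to it.\<close>

lemma oscillatory_increment_bound:
  fixes G \<phi> \<phi>' :: "complex \<Rightarrow> complex" and p q :: real
  assumes S: "S \<subseteq> \<real>" "convex S" and ab: "a \<in> S" "b \<in> S"
    and G: "\<And>z. z \<in> S \<Longrightarrow> (G has_field_derivative
      \<phi> z * (c * exp (\<i> * of_real p * z) + d * exp (\<i> * of_real q * z))) (at z within S)"
    and \<phi>: "\<And>z. z \<in> S \<Longrightarrow> (\<phi> has_field_derivative \<phi>' z) (at z within S)"
    and bounds: "\<And>z. z \<in> S \<Longrightarrow> norm (\<phi> z) \<le> B" "\<And>z. z \<in> S \<Longrightarrow> norm (\<phi>' z) \<le> B'"
    and pq: "p \<noteq> 0" "q \<noteq> 0" and cd: "norm c \<le> 1" "norm d \<le> 1"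
  shows "norm (G a - G b) \<le> (B' * norm (a - b) + 2 * B) * (1 / \<bar>p\<bar> + 1 / \<bar>q\<bar>)"
proof -
  define e where "e z =
      c * exp (\<i> * of_real p * z) / (\<i> * of_real p)
      + d * exp (\<i> * of_real q * z) / (\<i> * of_real q)" for z
  let ?K = "1 / \<bar>p\<bar> + 1 / \<bar>q\<bar>"
  have e_bound: "norm (e z) \<le> ?K" if "z \<in> S" for z
  proof -
    from that S obtain r where z: "z = of_real r" by (auto elim: Reals_cases)
    have "norm (exp (\<i> * of_real p * z)) = 1" "norm (exp (\<i> * of_real q * z)) = 1"
      by (simp_all add: z flip: of_real_mult mult.assoc)
    then have "norm (c * exp (\<i> * of_real p * z) / (\<i> * of_real p)) \<le> 1 / \<bar>p\<bar>"
      "norm (d * exp (\<i> * of_real q * z) / (\<i> * of_real q)) \<le> 1 / \<bar>q\<bar>"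
      using cd by (simp_all add: norm_mult norm_divide divide_right_mono del: norm_exp_eq_Re)
    then show ?thesis unfolding e_def by (intro norm_triangle_mono)
  qed
  have deriv: "((\<lambda>z. G z - \<phi> z * e z) has_field_derivative - (\<phi>' z * e z)) (at z within S)"
      if "z \<in> S" for z
    unfolding e_def using pq that
    by (auto intro!: derivative_eq_intros G \<phi> simp: field_simps)
  have "norm ((G a - \<phi> a * e a) - (G b - \<phi> b * e b)) \<le> (B' * ?K) * norm (a - b)"
  proof (rule field_differentiable_bound[OF S(2) deriv _ ab])
    fix z assume z: "z \<in> S"
    have "0 \<le> B'" using bounds(2)[OF z] norm_ge_zero order_trans by blast
    then show "norm (- (\<phi>' z * e z)) \<le> B' * ?K"
      using z by (auto simp: norm_mult intro!: mult_mono bounds e_bound)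
  qed
  moreover have "norm (\<phi> z * e z) \<le> B * ?K" if "z \<in> S" for z
  proof -
    have "0 \<le> B" using bounds(1)[OF that] norm_ge_zero order_trans by blast
    then show ?thesis using that by (auto simp: norm_mult intro!: mult_mono bounds e_bound)
  qed
  from this[OF ab(1)] this[OF ab(2)]
  have "norm (\<phi> a * e a - \<phi> b * e b) \<le> B * ?K + B * ?K"
    by (intro order_trans[OF norm_triangle_ineq4] add_mono)
  moreover have "G a - G b = ((G a - \<phi> a * e a) - (G b - \<phi> b * e b)) + (\<phi> a * e a - \<phi> b * e b)"
      by simp
  ultimately have "norm (G a - G b) \<le> (B' * ?K) * norm (a - b) + (B * ?K + B * ?K)"
    by (metis norm_triangle_mono)
  then show ?thesis by (simp add: algebra_simps)
qed

text \<open>The factor \<open>1 + exp (\<i> z)\<close> makes the sum telescope and leaves the two end terms, because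
  multiplication by \<open>exp (\<i> z)\<close> maps each term to the negative of the next one.\<close>

lemma alternating_geometric_sum:
  fixes z :: complex
  shows "(1 + exp (\<i> * z)) * (\<Sum>n\<in>{- int M..int N}.
      of_real (cos (pi * of_int n)) * exp (\<i> * of_int n * z)) =
    of_real (cos (pi * of_int N)) * exp (\<i> * of_nat (Suc N) * z)
        + of_real (cos (pi * of_int M)) * exp (- \<i> * of_nat M * z)"
proof -
  let ?b = "\<lambda>n::int. complex_of_real (cos (pi * of_int n)) * exp (\<i> * of_int n * z)"
  have shift: "exp (\<i> * z) * ?b n = - ?b (n + 1)" for n
    by (auto simp: algebra_simps simp flip: exp_add)
  have "(\<Sum>n\<in>{- int M..int N}. ?b n - ?b (n + 1)) = ?b (- int M) - ?b (int N + 1)"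
  proof (induction N)
    case 0
    show ?case
    proof (induction M)
      case (Suc M)
      have "{- int (Suc M)..int 0} = insert (- int (Suc M)) {- int M..int 0}" by auto
      then show ?case using Suc by (simp del: cos_npi_int)
    qed simp
  next
    case (Suc N)
    have "{- int M..int (Suc N)} = insert (int (Suc N)) {- int M..int N}" by auto
    then show ?case using Suc by (simp del: cos_npi_int add: add_ac)
  qed
  moreover have "(1 + exp (\<i> * z)) * (\<Sum>n\<in>{- int M..int N}. ?b n) =
      (\<Sum>n\<in>{- int M..int N}. ?b n - ?b (n + 1))"
    by (simp only: ring_distribs sum_distrib_left shift mult_1 sum.distrib[symmetric]
        diff_conv_add_uminus)
  ultimately show ?thesis by (auto simp: algebra_simps)
qed

lemma norm_1_plus_cis: "(norm (1 + cis t))\<^sup>2 = 2 + 2 * cos t"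
  unfolding cmod_power2 using sin_cos_squared_add[of t]
      by (simp add: power2_eq_square algebra_simps)

text \<open>As a function of the frequency \<open>\<tau>\<close>, the truncated series multiplied by \<open>cis (- \<tau> * x)\<close> is a
  combination of the exponentials with exponents \<open>\<i> (n - x) \<tau>\<close>. Differentiation cancels the
  denominators \<open>x - n\<close> of the cardinal sines and leaves an alternating geometric sum, which
  consists of two oscillating terms with frequencies \<open>N + 1\<close> and \<open>-M\<close>. Hence the function hardly
  changes between \<open>0\<close> and \<open>\<sigma>\<close>. The bound depends on the distance of \<open>cis \<sigma>\<close> from \<open>-1\<close>, which is
  positive for frequencies below \<open>pi\<close>.\<close>

lemma sampling_remainder_bound:
  fixes \<sigma> R x :: real
  assumes \<sigma>: "\<bar>\<sigma>\<bar> < pi" and R: "\<bar>x\<bar> \<le> R" and M: "0 < M"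
  shows "norm (cis (- \<sigma> * x) * (\<Sum>n\<in>{- int M..int N}.
      cis (\<sigma> * of_int n) * of_real (sinc (x - of_int n)))
      - of_real (\<Sum>n\<in>{- int M..int N}. sinc (x - of_int n)))
    \<le> ((R / norm (1 + cis \<sigma>) + 1 / (norm (1 + cis \<sigma>))\<^sup>2) * \<bar>\<sigma>\<bar>
        + 2 / norm (1 + cis \<sigma>)) * (1 / real (Suc N) + 1 / real M)"
proof -
  let ?I = "{- int M..int N}"
  define \<delta> where "\<delta> = norm (1 + cis \<sigma>)"
  define S where "S = complex_of_real ` {- \<bar>\<sigma>\<bar>..\<bar>\<sigma>\<bar>}"
  define G where "G z =
      (\<Sum>n\<in>?I. of_real (sinc (x - of_int n)) * exp (\<i> * of_real (of_int n - x) * z))" for z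
  \<comment> \<open>Up to the constant \<open>k\<close>, the slowly varying amplitude in the derivative of \<open>G\<close>.\<close>
  define \<phi> where "\<phi> z = exp (- \<i> * of_real x * z) / (1 + exp (\<i> * z))" for z
  define \<phi>' where "\<phi>' z =
      - \<i> * of_real x * \<phi> z - \<i> * exp (\<i> * z) * exp (- \<i> * of_real x * z) / (1 + exp (\<i> * z))\<^sup>2"
      for z
  define k where "k = - \<i> * of_real (sin (pi * x) / pi)"
  have "0 < 1 + cos \<sigma>"
    using \<sigma> cos_monotone_0_pi[of "\<bar>\<sigma>\<bar>" pi] by simp
  then have \<delta>_pos: "0 < \<delta>"
    using norm_1_plus_cis[of \<sigma>] unfolding \<delta>_def by (smt (verit) norm_ge_zero zero_power2)
  have \<delta>_le: "\<delta> \<le> norm (1 + exp (\<i> * z))" if "z \<in> S" for z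
  proof -
    from that obtain t where t: "z = of_real t" "\<bar>t\<bar> \<le> \<bar>\<sigma>\<bar>" by (auto simp: S_def)
    have "cos \<bar>\<sigma>\<bar> \<le> cos \<bar>t\<bar>"
      using t(2) \<sigma> by (intro cos_monotone_0_pi_le) linarith+
    then have "\<delta>\<^sup>2 \<le> (norm (1 + cis t))\<^sup>2" unfolding \<delta>_def norm_1_plus_cis by simp
    then have "\<delta> \<le> norm (1 + cis t)" by (rule power2_le_imp_le) simp
    then show ?thesis by (simp add: t cis_conv_exp)
  qed
  then have nz: "1 + exp (\<i> * z) \<noteq> 0" if "z \<in> S" for z
    using that \<delta>_pos by fastforce
  have \<phi>_bound: "norm (\<phi> z) \<le> 1 / \<delta>" if "z \<in> S" for z
  proof -
    from that obtain t where t: "z = of_real t" by (auto simp: S_def)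
    have "norm (exp (- \<i> * of_real x * z)) = 1"
      by (simp add: t norm_exp_eq_Re)
    then show ?thesis using \<delta>_le[OF that] \<delta>_pos
        by (simp add: \<phi>_def norm_divide frac_le del: norm_exp_eq_Re)
  qed
  have \<phi>'_bound: "norm (\<phi>' z) \<le> R / \<delta> + 1 / \<delta>\<^sup>2" if "z \<in> S" for z
  proof -
    from that obtain t where t: "z = of_real t" by (auto simp: S_def)
    have "norm (exp (- \<i> * of_real x * z)) = 1" "norm (exp (\<i> * z)) = 1"
      by (simp_all add: t norm_exp_eq_Re)
    then have "norm (\<i> * exp (\<i> * z) * exp (- \<i> * of_real x * z) / (1 + exp (\<i> * z))\<^sup>2) \<le> 1 / \<delta>\<^sup>2"
      using \<delta>_le[OF that] \<delta>_pos
          by (simp add: norm_divide norm_mult norm_power frac_le del: norm_exp_eq_Re)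
    moreover have "norm (- \<i> * of_real x * \<phi> z) \<le> R * (1 / \<delta>)"
      using mult_mono'[OF R \<phi>_bound[OF that]] by (simp add: norm_mult)
    ultimately show ?thesis unfolding \<phi>'_def
      by (intro order_trans[OF norm_triangle_ineq4]) simp
  qed
  have \<phi>_deriv: "(\<phi> has_field_derivative \<phi>' z) (at z within S)" if "z \<in> S" for z
    unfolding \<phi>_def \<phi>'_def using nz[OF that]
    by (auto intro!: derivative_eq_intros simp: power2_eq_square divide_simps)
  have G_deriv: "(G has_field_derivative
      \<phi> z * (k * of_real (cos (pi * of_int N)) * exp (\<i> * of_real (real (Suc N)) * z) +
        k * of_real (cos (pi * of_int M)) * exp (\<i> * of_real (- real M) * z))) (at z within S)"
            if "z \<in> S" for z
  proof -
    have "(G has_field_derivative (\<Sum>n\<in>?I. of_real (sinc (x - of_int n)) *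
        (exp (\<i> * of_real (of_int n - x) * z) * (\<i> * of_real (of_int n - x))))) (at z within S)"
      unfolding G_def by (auto intro!: derivative_eq_intros sum.cong simp: mult_ac)
    also have "(\<Sum>n\<in>?I. of_real (sinc (x - of_int n)) *
        (exp (\<i> * of_real (of_int n - x) * z) * (\<i> * of_real (of_int n - x))))
      = (\<Sum>n\<in>?I. k * exp (- \<i> * of_real x * z) *
          (of_real (cos (pi * of_int n)) * exp (\<i> * of_int n * z)))"
    proof (intro sum.cong refl)
      fix n :: int
      have "of_real (sinc (x - of_int n)) * (\<i> * of_real (of_int n - x)) =
          - \<i> * complex_of_real ((x - of_int n) * sinc (x - of_int n))" by (simp add: algebra_simps)
      also have "\<dots> = k * of_real (cos (pi * of_int n))"
        unfolding sinc_shift_mult k_def by simp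
      finally have 1: "of_real (sinc (x - of_int n)) * (\<i> * of_real (of_int n - x)) =
          k * complex_of_real (cos (pi * of_int n))" .
      have 2: "exp (\<i> * of_real (of_int n - x) * z) =
          exp (- \<i> * of_real x * z) * exp (\<i> * of_int n * z)"
        by (simp add: algebra_simps flip: exp_add)
      show "of_real (sinc (x - of_int n)) *
          (exp (\<i> * of_real (of_int n - x) * z) * (\<i> * of_real (of_int n - x)))
        = k * exp (- \<i> * of_real x * z) * (of_real (cos (pi * of_int n)) * exp (\<i> * of_int n * z))"
        using 1 unfolding 2 by (metis (no_types, lifting) mult.assoc mult.commute)
    qed
    also have "\<dots> = k * \<phi> z * ((1 + exp (\<i> * z)) *
        (\<Sum>n\<in>?I. of_real (cos (pi * of_int n)) * exp (\<i> * of_int n * z)))"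
      unfolding \<phi>_def using nz[OF that] by (simp add: sum_distrib_left mult.assoc)
    finally show ?thesis
      unfolding alternating_geometric_sum by (simp add: algebra_simps del: cos_npi_int)
  qed
  have k: "norm k \<le> 1"
  proof -
    have "\<bar>sin (pi * x)\<bar> \<le> pi" using abs_sin_le_one[of "pi * x"] pi_gt3 by linarith
    then show ?thesis by (simp add: k_def norm_mult norm_divide)
  qed
  have "norm (G (of_real \<sigma>) - G 0) \<le>
      ((R / \<delta> + 1 / \<delta>\<^sup>2) * norm (of_real \<sigma> - 0 :: complex) + 2 * (1 / \<delta>)) * (1 / \<bar>real (Suc N)\<bar>
          + 1 / \<bar>- real M\<bar>)"
  proof (rule oscillatory_increment_bound[where S = S and \<phi> = \<phi> and \<phi>' = \<phi>'
        and p = "real (Suc N)" and c = "k * of_real (cos (pi * of_int N))"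
        and q = "- real M" and d = "k * of_real (cos (pi * of_int M))"])
    show "S \<subseteq> \<real>" "convex S"
      by (auto simp: S_def intro!: convex_linear_image linear_of_real)
    show "complex_of_real \<sigma> \<in> S"
      unfolding S_def by (rule imageI) auto
    show "0 \<in> S"
      unfolding S_def by (rule image_eqI[of _ _ 0]) auto
  qed (use M G_deriv \<phi>_deriv \<phi>_bound \<phi>'_bound k in \<open>auto simp: norm_mult norm_power\<close>)
  moreover have "G 0 = of_real (\<Sum>n\<in>?I. sinc (x - of_int n))" by (simp add: G_def)
  moreover have "G (of_real \<sigma>) =
      cis (- \<sigma> * x) * (\<Sum>n\<in>?I. cis (\<sigma> * of_int n) * of_real (sinc (x - of_int n)))"
    unfolding G_def sum_distrib_left
    by (intro sum.cong refl) (simp add: cis_conv_exp algebra_simps flip: exp_add)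
  ultimately show ?thesis by (simp add: \<delta>_def)
qed

text \<open>The remainder bound reduces the claim to frequency zero, that is, to the interpolation of
  the constant.\<close>

lemma uniform_limit_sampling_cis:
  assumes \<sigma>: "\<bar>\<sigma>\<bar> < pi" and X: "bounded X"
  shows "uniform_limit X
      (\<lambda>MN x. bilateral_sum (\<lambda>n. cis (\<sigma> * of_int n) * of_real (sinc (x - of_int n))) UNIV MN)
    (\<lambda>x. cis (\<sigma> * x)) (sequentially \<times>\<^sub>F sequentially)"
proof -
  obtain R where R: "\<And>x. x \<in> X \<Longrightarrow> \<bar>x\<bar> \<le> R" using X by (auto simp: bounded_iff)
  let ?F = "sequentially \<times>\<^sub>F sequentially"
  let ?S = "\<lambda>MN x. bilateral_sum (\<lambda>n. cis (\<sigma> * of_int n) * of_real (sinc (x - of_int n))) UNIV MN"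
  let ?T = "\<lambda>MN x. bilateral_sum (\<lambda>n. sinc (x - of_int n)) UNIV MN"
  define C where "C = (R / norm (1 + cis \<sigma>) + 1 / (norm (1 + cis \<sigma>))\<^sup>2) * \<bar>\<sigma>\<bar>
      + 2 / norm (1 + cis \<sigma>)"
  have "uniform_limit X (\<lambda>MN x. cis (- \<sigma> * x) * ?S MN x - of_real (?T MN x)) (\<lambda>_. 0) ?F"
  proof (rule uniform_limit_null_comparison)
    have "\<forall>\<^sub>F MN in ?F. 0 < fst MN"
      by (rule eventually_compose_filterlim[OF eventually_gt_at_top filterlim_fst])
    then show "\<forall>\<^sub>F MN in ?F. \<forall>x\<in>X. norm (cis (- \<sigma> * x) * ?S MN x - of_real (?T MN x))
        \<le> C * (1 / real (Suc (snd MN)) + 1 / real (fst MN))"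
    proof eventually_elim
      case (elim MN)
      then show ?case
        using sampling_remainder_bound[OF \<sigma> R, of _ "fst MN" "snd MN"]
        by (auto simp: bilateral_sum_def case_prod_beta C_def)
    qed
    have "((\<lambda>MN. C * (1 / real (Suc (snd MN)) + 1 / real (fst MN))) \<longlongrightarrow> C * (0 + 0)) ?F"
      by (intro tendsto_intros filterlim_compose[OF lim_1_over_n filterlim_fst]
          filterlim_compose[OF LIMSEQ_inverse_real_of_nat[unfolded inverse_eq_divide]
              filterlim_snd])
    then show "uniform_limit X (\<lambda>MN x. C * (1 / real (Suc (snd MN)) + 1 / real (fst MN))) (\<lambda>_. 0)
        ?F"
      by (auto simp: tendsto_iff uniform_limit_iff elim!: eventually_mono)
  qed
  from uniform_limit_add[OF this
      bounded_linear.uniform_limit[OF bounded_linear_of_real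
      uniform_limit_sinc_partition_of_unity[OF X]]]
  have "uniform_limit X (\<lambda>MN x. cis (- \<sigma> * x) * ?S MN x) (\<lambda>_. 1) ?F" by simp
  moreover have "dist (cis (- \<sigma> * x) * ?S MN x) 1 = dist (?S MN x) (cis (\<sigma> * x))" for MN x
  proof -
    have "cis (- \<sigma> * x) * ?S MN x - 1 = cis (- \<sigma> * x) * (?S MN x - cis (\<sigma> * x))"
      by (simp add: right_diff_distrib cis_mult)
    then show ?thesis by (simp add: dist_norm norm_mult)
  qed
  ultimately show ?thesis unfolding uniform_limit_iff by (simp only:)
qed

section \<open>Sampling of the orbits of the group\<close>

lemma cinner_exp_kak:
  "cinner (exp_kak t a) b = of_real (cos t) * cinner a b + of_real (sin t) * cinner (kak a) b"
proof -
  have "((\<lambda>n. of_real (cos t) * (ell2_nth a n * cnj (ell2_nth b n)) +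
      of_real (sin t) * (ell2_nth (kak a) n * cnj (ell2_nth b n))) has_sum
      (of_real (cos t) * cinner a b + of_real (sin t) * cinner (kak a) b)) UNIV"
    by (intro has_sum_add has_sum_cmult_right cinner_has_sum)
  then show ?thesis
    unfolding exp_kak_eq cinner_def[of "_ + _"]
    by (intro infsumI) (simp add: plus_ell2.rep_eq scaleR_ell2.rep_eq scaleR_conv_of_real
        algebra_simps)
qed

lemma mult_sinc_div_pi: "t * sinc (t / pi) = sin t"
  by (simp add: sinc_def)

text \<open>Pairing an orbit with a fixed vector gives a combination of \<open>cos t\<close> and \<open>sin t\<close>, hence a
  real-linear image of \<open>cis t\<close>; it is sampled with frequency \<open>\<gamma> * pi\<close> in the variable \<open>t / (\<gamma> *
  pi)\<close>.\<close>

lemma uniform_limit_orbit_sampling: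
  assumes \<gamma>: "0 < \<gamma>" "\<gamma> < 1" and S: "bounded S"
  shows "uniform_limit S
          (\<lambda>MN t. bilateral_sum
             (\<lambda>n. cinner (exp_kak (\<gamma> * of_int n * pi) a) b *
                 of_real (sinc (t / (\<gamma> * pi) - of_int n)))
             UNIV MN)
          (\<lambda>t. cinner (exp_kak t a) b)
          (sequentially \<times>\<^sub>F sequentially)"
proof -
  define \<sigma> where "\<sigma> = \<gamma> * pi"
  have \<sigma>: "0 < \<sigma>" "\<bar>\<sigma>\<bar> < pi" using \<gamma> by (auto simp: \<sigma>_def)
  define L where "L z = of_real (Re z) * cinner a b + of_real (Im z) * cinner (kak a) b" for z
  have L: "bounded_linear L"
    unfolding L_def
    by (intro bounded_linear_add bounded_linear_compose[OF bounded_linear_mult_left]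
        bounded_linear_compose[OF bounded_linear_of_real] bounded_linear_Re bounded_linear_Im)
  have "bounded ((\<lambda>t. t / \<sigma>) ` S)"
    using bounded_linear_image[OF S bounded_linear_divide] .
  from bounded_linear.uniform_limit[OF L
      uniform_limit_compose'[OF uniform_limit_sampling_cis[OF \<sigma>(2) this], of "\<lambda>t. t / \<sigma>" S]]
  have "uniform_limit S (\<lambda>MN t.
      L (bilateral_sum (\<lambda>n. cis (\<sigma> * of_int n) * of_real (sinc (t / \<sigma> - of_int n))) UNIV MN))
      (\<lambda>t. L (cis (\<sigma> * (t / \<sigma>)))) (sequentially \<times>\<^sub>F sequentially)"
    by auto
  moreover have "L (cis (\<sigma> * (t / \<sigma>))) = cinner (exp_kak t a) b" for t
    using \<sigma> by (simp add: L_def cinner_exp_kak)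
  moreover have "L (bilateral_sum (\<lambda>n. cis (\<sigma> * of_int n) * of_real (sinc (t / \<sigma> - of_int n)))
      UNIV MN) =
      bilateral_sum (\<lambda>n. cinner (exp_kak (\<gamma> * of_int n * pi) a) b *
          of_real (sinc (t / (\<gamma> * pi) - of_int n))) UNIV MN" for MN t
  proof -
    have "L (cis (\<sigma> * of_int n) * of_real (sinc (t / \<sigma> - of_int n))) =
        cinner (exp_kak (\<gamma> * of_int n * pi) a) b * of_real (sinc (t / (\<gamma> * pi) - of_int n))" for n
      by (simp add: L_def cinner_exp_kak \<sigma>_def mult_ac ring_distribs)
    then show ?thesis
      by (cases MN) (simp add: bilateral_sum_def linear_sum[OF bounded_linear.linear[OF L]])
  qed
  ultimately show ?thesis by simp
qed

lemma exp_kak_of_int_pi: "exp_kak (of_int n * pi) a = cos (pi * of_int n) *\<^sub>R a"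
  unfolding exp_kak_eq by (subst (1 2) mult.commute) (simp del: cos_npi_int)

text \<open>At the nodes the orbit is \<open>cos (n * pi)\<close> times its starting point, so the series is the
  regularised interpolation series of the cosine in the variable \<open>t / pi\<close>.\<close>

lemma exp_kak_valiron_series:
  "((\<lambda>n. (t / (of_int n * pi) * sinc (t / pi - of_int n)) *\<^sub>R exp_kak (of_int n * pi) a) has_sum
    (cos t - sinc (t / pi)) *\<^sub>R a) (UNIV - {0})"
proof -
  have "((\<lambda>n. (t / pi / of_int n * (cos (pi * of_int n) * sinc (t / pi - of_int n))) *\<^sub>R a) has_sum
      (cos (pi * (t / pi)) - sinc (t / pi)) *\<^sub>R a) (UNIV - {0})"
    by (rule has_sum_bounded_linear[OF bounded_linear_scaleR_left cosine_has_sum_regularized])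
  moreover have "(t / (of_int n * pi) * sinc (t / pi - of_int n)) *\<^sub>R exp_kak (of_int n * pi) a =
      (t / pi / of_int n * (cos (pi * of_int n) * sinc (t / pi - of_int n))) *\<^sub>R a" for n
    unfolding exp_kak_of_int_pi by (simp add: mult_ac del: cos_npi_int)
  ultimately show ?thesis by simp
qed

text \<open>Subtracting \<open>a\<close> at each node subtracts the regularised interpolation series of the constant \<open>1\<close>.\<close>

lemma exp_kak_difference_series:
  "((\<lambda>n. t *\<^sub>R sinc (t / pi - of_int n) *\<^sub>R ((exp_kak (of_int n * pi) a - a) /\<^sub>R (of_int n * pi)))
      has_sum
    (cos t - 1) *\<^sub>R a) (UNIV - {0})"
proof -
  have "((\<lambda>n. (t / pi / of_int n * sinc (t / pi - of_int n)) *\<^sub>R a)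
      has_sum (1 - sinc (t / pi)) *\<^sub>R a) (UNIV - {0})"
    by (rule has_sum_bounded_linear[OF bounded_linear_scaleR_left constant_has_sum_regularized])
  from has_sum_add[OF exp_kak_valiron_series[of t a]
      has_sum_bounded_linear[OF bounded_linear_minus[OF bounded_linear_ident] this]]
  have "((\<lambda>n. (t / (of_int n * pi) * sinc (t / pi - of_int n)) *\<^sub>R exp_kak (of_int n * pi) a
      - (t / pi / of_int n * sinc (t / pi - of_int n)) *\<^sub>R a) has_sum (cos t - 1) *\<^sub>R a)
          (UNIV - {0})"
    by (simp add: scaleR_left_diff_distrib)
  moreover have "(t / (of_int n * pi) * sinc (t / pi - of_int n)) *\<^sub>R exp_kak (of_int n * pi) a
      - (t / pi / of_int n * sinc (t / pi - of_int n)) *\<^sub>R a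
    = t *\<^sub>R sinc (t / pi - of_int n) *\<^sub>R ((exp_kak (of_int n * pi) a - a) /\<^sub>R (of_int n * pi))"
        for n
    by (simp add: scaleR_right_diff_distrib divide_inverse mult_ac)
  ultimately show ?thesis by simp
qed

theorem theorem6p2:
  fixes a a' :: ell2 and \<gamma> :: real
  assumes "0 < \<gamma>" and "\<gamma> < 1"
  shows
    "(\<forall>t. has_bilateral_sum
        (\<lambda>n. cinner (exp_kak (\<gamma> * of_int n * pi) a) a' * of_real (sinc (t / (\<gamma> * pi) - of_int n)))
        UNIV (cinner (exp_kak t a) a')) \<and>
     (\<forall>S. compact S \<longrightarrow>
        uniform_limit S
          (\<lambda>MN t. bilateral_sum
             (\<lambda>n. cinner (exp_kak (\<gamma> * of_int n * pi) a) a' * of_real (sinc (t / (\<gamma> * pi) - of_int n)))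
             UNIV MN)
          (\<lambda>t. cinner (exp_kak t a) a')
          (sequentially \<times>\<^sub>F sequentially)) \<and>
     (\<forall>t. \<exists>s. has_bilateral_sum
          (\<lambda>n. sinc (t / pi - of_int n) *\<^sub>R ((exp_kak (of_int n * pi) a - a) /\<^sub>R (of_int n * pi)))
          (UNIV - {0}) s \<and>
        exp_kak t a = a + (t * sinc (t / pi)) *\<^sub>R kak a + t *\<^sub>R s) \<and>
     (\<forall>t. \<exists>s. has_bilateral_sum
          (\<lambda>n. (t / (of_int n * pi) * sinc (t / pi - of_int n)) *\<^sub>R exp_kak (of_int n * pi) a)
          (UNIV - {0}) s \<and>
        exp_kak t a = sinc (t / pi) *\<^sub>R a + (t * sinc (t / pi)) *\<^sub>R kak a + s)"
proof (intro conjI allI impI)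
  fix S :: "real set" assume "compact S"
  then show "uniform_limit S
      (\<lambda>MN t. bilateral_sum
         (\<lambda>n. cinner (exp_kak (\<gamma> * of_int n * pi) a) a' * of_real (sinc (t / (\<gamma> * pi) - of_int n)))
         UNIV MN)
      (\<lambda>t. cinner (exp_kak t a) a')
      (sequentially \<times>\<^sub>F sequentially)"
    by (intro uniform_limit_orbit_sampling assms compact_imp_bounded)
next
  fix t :: real
  show "has_bilateral_sum
      (\<lambda>n. cinner (exp_kak (\<gamma> * of_int n * pi) a) a' * of_real (sinc (t / (\<gamma> * pi) - of_int n)))
      UNIV (cinner (exp_kak t a) a')"
    unfolding has_bilateral_sum_def
    using tendsto_uniform_limitI[OF uniform_limit_orbit_sampling[OF assms, of "{t}"], of t] by simp
next
  fix t :: real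
  show "\<exists>s. has_bilateral_sum
      (\<lambda>n. sinc (t / pi - of_int n) *\<^sub>R ((exp_kak (of_int n * pi) a - a) /\<^sub>R (of_int n * pi)))
      (UNIV - {0}) s \<and>
    exp_kak t a = a + (t * sinc (t / pi)) *\<^sub>R kak a + t *\<^sub>R s"
  \<comment> \<open>The series in the claim lacks the factor \<open>t\<close>, which has to be divided out; at \<open>0\<close> it vanishes
      termwise.\<close>
  proof (cases "t = 0")
    case True
    have "((\<lambda>n. sinc (t / pi - of_int n) *\<^sub>R ((exp_kak (of_int n * pi) a - a) /\<^sub>R (of_int n * pi)))
        has_sum 0) (UNIV - {0})"
    proof (rule has_sum_0)
      fix n :: int assume "n \<in> UNIV - {0}"
      then show "sinc (t / pi - of_int n)
          *\<^sub>R ((exp_kak (of_int n * pi) a - a) /\<^sub>R (of_int n * pi)) = 0"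
        using sinc_of_int[of "- n"] True by simp
    qed
    then show ?thesis
      using True by (intro exI[of _ 0]) (simp add: has_sum_imp_has_bilateral_sum exp_kak_eq)
  next
    case False
    have cancel: "t *\<^sub>R y /\<^sub>R t = y" for y :: ell2 using False by simp
    have "((\<lambda>n. sinc (t / pi - of_int n) *\<^sub>R ((exp_kak (of_int n * pi) a - a) /\<^sub>R (of_int n * pi)))
        has_sum (cos t - 1) *\<^sub>R a /\<^sub>R t) (UNIV - {0})"
      using has_sum_bounded_linear[OF bounded_linear_scaleR_right[of "inverse t"]
          exp_kak_difference_series[of t a]]
      by (simp only: cancel)
    then show ?thesis
      using False by (intro exI[of _ "(cos t - 1) *\<^sub>R a /\<^sub>R t"])
        (simp add: has_sum_imp_has_bilateral_sum exp_kak_eq mult_sinc_div_pi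
            scaleR_left_diff_distrib)
  qed
next
  fix t :: real
  show "\<exists>s. has_bilateral_sum
      (\<lambda>n. (t / (of_int n * pi) * sinc (t / pi - of_int n)) *\<^sub>R exp_kak (of_int n * pi) a)
      (UNIV - {0}) s \<and>
    exp_kak t a = sinc (t / pi) *\<^sub>R a + (t * sinc (t / pi)) *\<^sub>R kak a + s"
    by (intro exI[of _ "(cos t - sinc (t / pi)) *\<^sub>R a"] conjI has_sum_imp_has_bilateral_sum
        exp_kak_valiron_series)
       (simp add: exp_kak_eq mult_sinc_div_pi scaleR_left_diff_distrib)
qed

end
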